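(* Let $k$ be a field of characteristic $0$, let $(M,+,0,<)$ be a partially ordered monoid and let $\mathbb{A}=k(\!(M)\!)$ be the algebra of Noetherian series with exponents in $M$. Then the group $1\text{-}\mathrm{Aut}^+_k(\mathbb{A})$ (under composition) is divisible and torsion-free.
   Context: A partially ordered set is Noetherian if it has no infinite antichain and every non-empty chain in it has a minimal element. A partially ordered monoid is a (not necessarily commutative) monoid $(M,+,0)$ with a partial (strict) ordering $<$ such that $f<g$ implies $f+h<g+h$ and $h+f<h+g$. $k(\!(M)\!)$ is the vector space of maps $a\colon M\to k$ whose support $\mathrm{supp}\,a=\{m:a(m)\ne0\}$ is Noetherian, with Cauchy product $(a\cdot b)(m)=\sum_{m_1+m_2=m}a(m_1)b(m_2)$; it is a unital associative algebra. A family $\mathbf{f}\colon I\to k(\!(M)\!)$ is summable if $\bigcup_{i\in I}\mathrm{supp}\,\mathbf{f}(i)$ is Noetherian and for every $m\in M$ the set $\{i\in I:m\in\mathrm{supp}\,\mathbf{f}(i)\}$ is finite; its sum is $m\mapsto\sum_{i\in I}\mathbf{f}(i)(m)$. A linear map $\phi\colon\mathbb{A}\to\mathbb{A}$ is strongly linear if for every summable family $\mathbf{v}$, $\phi\circ\mathbf{v}$ is summable and $\sum_i\phi(\mathbf{v}(i))=\phi(\sum_i\mathbf{v}(i))$. For $v,w\in\mathbb{A}$, $v\prec w$ means $w\neq0$ and for every $p\in\mathrm{supp}\,v$ there is $q\in\mathrm{supp}\,w$ with $p>q$. $1\text{-}\mathrm{Aut}^+_k(\mathbb{A})$ is the group of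 bijective strongly linear algebra morphisms $\sigma\colon\mathbb{A}\to\mathbb{A}$ with $\sigma(a)-a\prec a$ for all $a\in\mathbb{A}\setminus\{0\}$. A (not necessarily commutative) group is divisible if for every $n\ge1$ each element is an $n$-th power. *)

theory Defs
  imports Complex_Main "HOL-Library.Ramsey" "HOL-Algebra.Group"
begin

section \<open>Noetherian sets\<close>

definition noetherian :: "'a::order set \<Rightarrow> bool" where
  "noetherian S \<longleftrightarrow>
     (\<forall>A\<subseteq>S. pairwise (\<lambda>x y. \<not> x \<le> y \<and> \<not> y \<le> x) A \<longrightarrow> finite A) \<and>
     (\<forall>C\<subseteq>S. C \<noteq> {} \<and> Complete_Partial_Order.chain (\<le>) C \<longrightarrow> (\<exists>m\<in>C. \<forall>x\<in>C. \<not> x < m))"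

lemma noetherian_antichainD:
  "noetherian S \<Longrightarrow> A \<subseteq> S \<Longrightarrow> pairwise (\<lambda>x y. \<not> x \<le> y \<and> \<not> y \<le> x) A \<Longrightarrow> finite A"
  unfolding noetherian_def by blast

lemma noetherian_chainD:
  "noetherian S \<Longrightarrow> C \<subseteq> S \<Longrightarrow> C \<noteq> {} \<Longrightarrow> Complete_Partial_Order.chain (\<le>) C \<Longrightarrow>
    \<exists>m\<in>C. \<forall>x\<in>C. \<not> x < m"
  unfolding noetherian_def by blast

lemma noetherian_subset:
  assumes T: "noetherian T" and S: "S \<subseteq> T"
  shows "noetherian S"
  unfolding noetherian_def
proof (intro conjI allI impI)
  fix A assume "A \<subseteq> S" "pairwise (\<lambda>x y. \<not> x \<le> y \<and> \<not> y \<le> x) A"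
  then show "finite A" by (intro noetherian_antichainD[OF T subset_trans[OF _ S]])
next
  fix C assume "C \<subseteq> S" "C \<noteq> {} \<and> Complete_Partial_Order.chain (\<le>) C"
  then show "\<exists>m\<in>C. \<forall>x\<in>C. \<not> x < m"
    by (intro noetherian_chainD[OF T subset_trans[OF _ S]]) simp_all
qed

lemma noetherian_mono_subseq:
  fixes s :: "nat \<Rightarrow> 'a::order"
  assumes S: "noetherian S" and s: "\<And>n. s n \<in> S"
  obtains r :: "nat \<Rightarrow> nat" where "strict_mono r" "mono (s \<circ> r)"
proof -
  define f :: "nat set \<Rightarrow> nat" where
    "f X = (if s (Min X) \<le> s (Max X) then 0 else if s (Max X) \<le> s (Min X) then 1 else 2)" for X
  have f: "f {i, j} = (if s i \<le> s j then 0 else if s j \<le> s i then 1 else 2)" if "i < j" for i j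
    using that by (simp add: f_def)
  have "\<forall>x\<in>UNIV. \<forall>y\<in>UNIV. x \<noteq> y \<longrightarrow> f {x, y} < 3"
    by (simp add: f_def)
  from Ramsey2[OF infinite_UNIV_nat this] obtain Y t where
    Y: "infinite Y" and t: "t < 3" and Yt: "\<And>x y. x \<in> Y \<Longrightarrow> y \<in> Y \<Longrightarrow> x \<noteq> y \<Longrightarrow> f {x, y} = t"
    by blast
  have ft: "t = (if s i \<le> s j then 0 else if s j \<le> s i then 1 else 2)"
    if "i \<in> Y" "j \<in> Y" "i < j" for i j
    using Yt[OF that(1,2)] f[OF that(3)] that(3) by (metis less_irrefl)
  have ex: "\<exists>j\<in>Y. i < j" for i
    using Y by (meson infinite_nat_iff_unbounded)
  consider "t = 0" | "t = 1" | "t = 2" using t by linarith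
  then show ?thesis
  proof cases
    case 1
    have le: "s i \<le> s j" if "i \<in> Y" "j \<in> Y" "i \<le> j" for i j
      using ft[OF that(1,2)] that(3) 1 by (cases "i = j") (simp_all split: if_splits)
    have sm: "strict_mono (enumerate Y)" using Y by (rule strict_mono_enumerate)
    have "mono (s \<circ> enumerate Y)"
    proof (rule monoI)
      fix i j :: nat assume "i \<le> j"
      then have "enumerate Y i \<le> enumerate Y j" using sm by (simp only: strict_mono_less_eq)
      then show "(s \<circ> enumerate Y) i \<le> (s \<circ> enumerate Y) j"
        using le[OF enumerate_in_set[OF Y] enumerate_in_set[OF Y]] by simp
    qed
    with sm show ?thesis by (rule that)
  next
    case 2
    have gt: "s j < s i" if "i \<in> Y" "j \<in> Y" "i < j" for i j
      using ft[OF that] 2 by (simp add: less_le_not_le split: if_splits)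
    have "Complete_Partial_Order.chain (\<le>) (s ` Y)"
    proof (rule Complete_Partial_Order.chainI)
      fix x y assume "x \<in> s ` Y" "y \<in> s ` Y"
      then obtain i j where "x = s i" "y = s j" "i \<in> Y" "j \<in> Y" by blast
      then show "x \<le> y \<or> y \<le> x"
        using gt[of i j] gt[of j i] by (cases i j rule: linorder_cases) (auto simp: less_imp_le)
    qed
    from noetherian_chainD[OF S _ _ this] s Y obtain i where
      i: "i \<in> Y" "\<forall>x\<in>s ` Y. \<not> x < s i" by fastforce
    from ex[of i] obtain j where "j \<in> Y" "i < j" by blast
    with i gt[of i j] show ?thesis by blast
  next
    case 3
    have inc: "\<not> s i \<le> s j \<and> \<not> s j \<le> s i" if "i \<in> Y" "j \<in> Y" "i \<noteq> j" for i j
      using ft[of i j] ft[of j i] that 3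
      by (cases i j rule: linorder_cases) (simp_all split: if_splits)
    then have "inj_on s Y" by (force simp: inj_on_def)
    then have "infinite (s ` Y)" using Y finite_imageD by blast
    moreover have "pairwise (\<lambda>x y. \<not> x \<le> y \<and> \<not> y \<le> x) (s ` Y)"
      using inc by (force simp: pairwise_def)
    moreover have "s ` Y \<subseteq> S" using s by auto
    ultimately show ?thesis using noetherian_antichainD[OF S] by blast
  qed
qed

lemma noetherianI_seq:
  assumes good: "\<And>s::nat \<Rightarrow> 'a::order. (\<And>n. s n \<in> S) \<Longrightarrow> \<exists>i j. i < j \<and> s i \<le> s j"
  shows "noetherian S"
  unfolding noetherian_def
proof (intro conjI allI impI)
  fix A assume A: "A \<subseteq> S" "pairwise (\<lambda>x y. \<not> x \<le> y \<and> \<not> y \<le> x) A"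
  show "finite A"
  proof (rule ccontr)
    assume "infinite A"
    then obtain s :: "nat \<Rightarrow> 'a" where s: "inj s" "range s \<subseteq> A"
      by (meson infinite_countable_subset)
    then obtain i j where "i < j" "s i \<le> s j" using good[of s] A(1) by blast
    moreover have "s i \<noteq> s j" using s(1) \<open>i < j\<close> by (metis injD less_irrefl)
    ultimately show False using A(2) s(2) unfolding pairwise_def by (meson range_subsetD)
  qed
next
  fix C assume C: "C \<subseteq> S" "C \<noteq> {} \<and> Complete_Partial_Order.chain (\<le>) C"
  show "\<exists>m\<in>C. \<forall>x\<in>C. \<not> x < m"
  proof (rule ccontr)
    assume "\<not> ?thesis"
    then have "\<exists>x. x \<in> C \<and> x < m" if "m \<in> C" for m using that by blast
    then obtain g where g: "\<And>m. m \<in> C \<Longrightarrow> g m \<in> C \<and> g m < m" by metis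
    from C obtain c where c: "c \<in> C" by blast
    define s where "s n = (g ^^ n) c" for n
    have sC: "s n \<in> C" for n by (induction n) (auto simp: s_def c g)
    have "s (Suc n) < s n" for n using g[OF sC[of n]] by (simp add: s_def)
    then have "s j < s i" if "i < j" for i j using that
      by (induction j) (auto simp: less_Suc_eq dest: less_trans[where 'a = 'a])
    then show False using good[of s] sC C(1) by (meson less_le_not_le subsetD)
  qed
qed

lemma noetherian_empty [simp]: "noetherian {}"
  by (rule noetherianI_seq) simp

lemma noetherian_singleton [simp]: "noetherian {x}"
  by (rule noetherianI_seq) (metis less_Suc_eq order_refl singletonD)

lemma noetherian_Un:
  assumes "noetherian S" "noetherian T"
  shows "noetherian (S \<union> T)"
proof (rule noetherianI_seq)
  fix s :: "nat \<Rightarrow> 'a" assume s: "\<And>n. s n \<in> S \<union> T"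
  have *: "\<exists>i j. i < j \<and> s i \<le> s j" if inf: "infinite {n. s n \<in> U}" and U: "noetherian U" for U
  proof -
    let ?e = "enumerate {n. s n \<in> U}"
    have "(s \<circ> ?e) n \<in> U" for n using enumerate_in_set[OF inf, of n] by simp
    then obtain r :: "nat \<Rightarrow> nat" where r: "strict_mono r" "mono ((s \<circ> ?e) \<circ> r)"
      by (rule noetherian_mono_subseq[OF U])
    have "?e (r 0) < ?e (r 1)"
      using strict_mono_enumerate[OF inf] r(1) by (simp add: strict_mono_less)
    moreover have "s (?e (r 0)) \<le> s (?e (r 1))" using monoD[OF r(2), of 0 1] by simp
    ultimately show ?thesis by blast
  qed
  have "{n. s n \<in> S} \<union> {n. s n \<in> T} = UNIV" using s by auto
  then have "infinite {n. s n \<in> S} \<or> infinite {n. s n \<in> T}"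
    by (metis finite_Un infinite_UNIV_nat)
  with * assms show "\<exists>i j. i < j \<and> s i \<le> s j" by blast
qed

section \<open>Partially ordered monoids\<close>

class partially_ordered_monoid_add = monoid_add + order +
  assumes add_strict_right: "f < g \<Longrightarrow> f + h < g + h"
    and add_strict_left: "f < g \<Longrightarrow> h + f < h + g"

lemma pom_add_mono:
  fixes a b c d :: "'m::partially_ordered_monoid_add"
  assumes "a \<le> b" "c \<le> d"
  shows "a + c \<le> b + d"
proof -
  have "a + c \<le> b + c" using assms(1) add_strict_right[of a b c] by (auto simp: le_less)
  also have "b + c \<le> b + d" using assms(2) add_strict_left[of c d b] by (auto simp: le_less)
  finally show ?thesis .
qed

lemma pom_add_eqD:
  fixes a b c d :: "'m::partially_ordered_monoid_add"
  assumes "a \<le> b" "c \<le> d" "a + c = b + d"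
  shows "a = b \<and> c = d"
proof (rule conjI)
  show "a = b"
  proof (rule ccontr)
    assume "a \<noteq> b"
    then have "a + c < b + c" using assms(1) by (intro add_strict_right) simp
    also have "b + c \<le> b + d" using assms(2) by (simp add: pom_add_mono)
    finally show False using assms(3) by simp
  qed
  show "c = d"
  proof (rule ccontr)
    assume "c \<noteq> d"
    then have "a + c < a + d" using assms(2) by (intro add_strict_left) simp
    also have "a + d \<le> b + d" using assms(1) by (simp add: pom_add_mono)
    finally show False using assms(3) by simp
  qed
qed

lemma noetherian_sumset:
  fixes S T :: "'m::partially_ordered_monoid_add set"
  assumes S: "noetherian S" and T: "noetherian T"
  shows "noetherian {x + y | x y. x \<in> S \<and> y \<in> T}"
proof (rule noetherianI_seq)
  fix s :: "nat \<Rightarrow> 'm" assume "\<And>n. s n \<in> {x + y | x y. x \<in> S \<and> y \<in> T}"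
  then have "\<forall>n. \<exists>x y. s n = x + y \<and> x \<in> S \<and> y \<in> T" by blast
  then obtain x y where xy: "\<And>n. s n = x n + y n" "\<And>n. x n \<in> S" "\<And>n. y n \<in> T" by metis
  from noetherian_mono_subseq[of S x, OF S xy(2)]
  obtain r :: "nat \<Rightarrow> nat" where r: "strict_mono r" "mono (x \<circ> r)" .
  have "(y \<circ> r) n \<in> T" for n using xy(3) by simp
  then obtain q :: "nat \<Rightarrow> nat" where q: "strict_mono q" "mono ((y \<circ> r) \<circ> q)"
    by (rule noetherian_mono_subseq[OF T])
  have "r (q 0) < r (q 1)" using r(1) q(1) by (simp add: strict_mono_less)
  moreover have "x (r (q 0)) \<le> x (r (q 1))"
    using monoD[OF r(2), of "q 0" "q 1"] q(1) by (simp add: strict_mono_less_eq)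
  moreover have "y (r (q 0)) \<le> y (r (q 1))" using monoD[OF q(2), of 0 1] by simp
  ultimately show "\<exists>i j. i < j \<and> s i \<le> s j" using xy(1) pom_add_mono by metis
qed

lemma finite_pairs:
  fixes S T :: "'m::partially_ordered_monoid_add set"
  assumes S: "noetherian S" and T: "noetherian T"
  shows "finite {(x, y). x \<in> S \<and> y \<in> T \<and> x + y = m}" (is "finite ?P")
proof (rule ccontr)
  assume "infinite ?P"
  then obtain p :: "nat \<Rightarrow> 'm \<times> 'm" where p: "inj p" "range p \<subseteq> ?P"
    by (meson infinite_countable_subset)
  define x y where "x = fst \<circ> p" and "y = snd \<circ> p"
  have pxy: "p n = (x n, y n)" for n by (simp add: x_def y_def)
  have xy: "x n \<in> S" "y n \<in> T" "x n + y n = m" for n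
    using subsetD[OF p(2) rangeI[of p n]] by (simp_all add: pxy)
  from noetherian_mono_subseq[of S x, OF S xy(1)]
  obtain r :: "nat \<Rightarrow> nat" where r: "strict_mono r" "mono (x \<circ> r)" .
  have "(y \<circ> r) n \<in> T" for n using xy(2) by simp
  then obtain q :: "nat \<Rightarrow> nat" where q: "strict_mono q" "mono ((y \<circ> r) \<circ> q)"
    by (rule noetherian_mono_subseq[OF T])
  have "x (r (q 0)) \<le> x (r (q 1))"
    using monoD[OF r(2), of "q 0" "q 1"] q(1) by (simp add: strict_mono_less_eq)
  moreover have "y (r (q 0)) \<le> y (r (q 1))" using monoD[OF q(2), of 0 1] by simp
  ultimately have "p (r (q 0)) = p (r (q 1))" using xy(3) pom_add_eqD pxy by metis
  then have "r (q 0) = r (q 1)" using p(1) by (simp add: inj_eq)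
  then show False using r(1) q(1) by (simp add: strict_mono_eq)
qed

section \<open>The algebra of Noetherian series\<close>

typedef (overloaded) ('m::order, 'k::zero) nseries = "{a :: 'm \<Rightarrow> 'k. noetherian {m. a m \<noteq> 0}}"
  morphisms coeff Abs_nseries
  by (rule exI[of _ "\<lambda>_. 0"]) simp

setup_lifting type_definition_nseries

definition supp :: "('m::order, 'k::zero) nseries \<Rightarrow> 'm set" where
  "supp a = {m. coeff a m \<noteq> 0}"

lemma noetherian_supp [simp]: "noetherian (supp a)"
  using coeff[of a] by (simp add: supp_def)

lemma nseries_eqI: "(\<And>m. coeff a m = coeff b m) \<Longrightarrow> a = b"
  by (metis coeff_inject ext)

instantiation nseries :: (order, ab_group_add) ab_group_add
begin

lift_definition zero_nseries :: "('a, 'b) nseries" is "\<lambda>_. 0" by simp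

lift_definition plus_nseries :: "('a, 'b) nseries \<Rightarrow> ('a, 'b) nseries \<Rightarrow> ('a, 'b) nseries"
  is "\<lambda>a b m. a m + b m"
  by (erule (1) noetherian_subset[OF noetherian_Un]) auto

lift_definition uminus_nseries :: "('a, 'b) nseries \<Rightarrow> ('a, 'b) nseries"
  is "\<lambda>a m. - a m" by simp

lift_definition minus_nseries :: "('a, 'b) nseries \<Rightarrow> ('a, 'b) nseries \<Rightarrow> ('a, 'b) nseries"
  is "\<lambda>a b m. a m - b m"
  by (erule (1) noetherian_subset[OF noetherian_Un]) auto

instance
  by standard (transfer; simp add: fun_eq_iff algebra_simps)+

end

lemma supp_zero [simp]: "supp 0 = {}"
  by (simp add: supp_def zero_nseries.rep_eq)

lemma supp_eq_empty_iff: "supp a = {} \<longleftrightarrow> a = 0"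
  by (auto simp: supp_def zero_nseries.rep_eq intro: nseries_eqI)

lift_definition scale :: "'k \<Rightarrow> ('m::order, 'k::semiring_0) nseries \<Rightarrow> ('m, 'k) nseries"
  is "\<lambda>c a m. c * a m"
  by (erule noetherian_subset) auto

lemma vector_space_scale:
  "vector_space (scale :: 'k::field \<Rightarrow> ('m::order, 'k) nseries \<Rightarrow> ('m, 'k) nseries)"
  by (standard; transfer; simp add: fun_eq_iff algebra_simps)

lemma noetherian_supp_times:
  fixes a b :: "'m::partially_ordered_monoid_add \<Rightarrow> 'k::semiring_0"
  assumes "noetherian {m. a m \<noteq> 0}" "noetherian {m. b m \<noteq> 0}"
  shows "noetherian {m. (\<Sum>(x, y) | a x \<noteq> 0 \<and> b y \<noteq> 0 \<and> x + y = m. a x * b y) \<noteq> 0}"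
proof (rule noetherian_subset[OF noetherian_sumset[OF assms]], rule subsetI)
  fix m assume "m \<in> {m. (\<Sum>(x, y) | a x \<noteq> 0 \<and> b y \<noteq> 0 \<and> x + y = m. a x * b y) \<noteq> 0}"
  then have "(\<Sum>(x, y) | a x \<noteq> 0 \<and> b y \<noteq> 0 \<and> x + y = m. a x * b y) \<noteq> 0" by simp
  then obtain p where "p \<in> {(x, y). a x \<noteq> 0 \<and> b y \<noteq> 0 \<and> x + y = m}"
    by (rule sum.not_neutral_contains_not_neutral)
  then show "m \<in> {x + y |x y. x \<in> {m. a m \<noteq> 0} \<and> y \<in> {m. b m \<noteq> 0}}" by auto
qed

instantiation nseries :: (partially_ordered_monoid_add, ring_1) ring_1
begin

lift_definition one_nseries :: "('a, 'b) nseries" is "\<lambda>m. if m = 0 then 1 else 0"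
  by (rule noetherian_subset[OF noetherian_singleton[of 0]]) auto

text \<open>The index set of the sum is finite by \<open>finite_pairs\<close>, so that the sum is the actual
  Cauchy product.\<close>

lift_definition times_nseries :: "('a, 'b) nseries \<Rightarrow> ('a, 'b) nseries \<Rightarrow> ('a, 'b) nseries"
  is "\<lambda>a b m. \<Sum>(x, y) | a x \<noteq> 0 \<and> b y \<noteq> 0 \<and> x + y = m. a x * b y"
  by (rule noetherian_supp_times)

lemma supp_times:
  fixes a b :: "('a, 'b) nseries"
  shows "supp (a * b) \<subseteq> {x + y | x y. x \<in> supp a \<and> y \<in> supp b}"
proof
  fix m assume "m \<in> supp (a * b)"
  then have "(\<Sum>(x, y) | coeff a x \<noteq> 0 \<and> coeff b y \<noteq> 0 \<and> x + y = m. coeff a x * coeff b y) \<noteq> 0"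
    by (simp add: supp_def times_nseries.rep_eq)
  then obtain p where "p \<in> {(x, y). coeff a x \<noteq> 0 \<and> coeff b y \<noteq> 0 \<and> x + y = m}"
    by (rule sum.not_neutral_contains_not_neutral)
  then show "m \<in> {x + y | x y. x \<in> supp a \<and> y \<in> supp b}" by (auto simp: supp_def)
qed

lemma coeff_times:
  fixes a b :: "('a, 'b) nseries"
  assumes S: "noetherian S" "supp a \<subseteq> S" and T: "noetherian T" "supp b \<subseteq> T"
  shows "coeff (a * b) m = (\<Sum>(x, y) | x \<in> S \<and> y \<in> T \<and> x + y = m. coeff a x * coeff b y)"
  unfolding times_nseries.rep_eq
  by (rule sum.mono_neutral_left[OF finite_pairs[OF S(1) T(1)]]) (use S(2) T(2) in \<open>auto simp: supp_def\<close>)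

instance
proof
  fix a b c :: "('a, 'b) nseries"
  let ?A = "supp a" and ?B = "supp b" and ?C = "supp c"
  let ?AB = "{x + y | x y. x \<in> ?A \<and> y \<in> ?B}" and ?BC = "{x + y | x y. x \<in> ?B \<and> y \<in> ?C}"
  have nAB: "noetherian ?AB" and nBC: "noetherian ?BC" by (simp_all add: noetherian_sumset)
  have sAB: "supp (a * b) \<subseteq> ?AB" and sBC: "supp (b * c) \<subseteq> ?BC"
    by (rule supp_times)+
  show "a * b * c = a * (b * c)"
  proof (rule nseries_eqI)
    fix m
    have "coeff (a * b * c) m =
        (\<Sum>u | fst u \<in> ?AB \<and> snd u \<in> ?C \<and> fst u + snd u = m.
          \<Sum>v | fst v \<in> ?A \<and> snd v \<in> ?B \<and> fst v + snd v = fst u.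
            coeff a (fst v) * coeff b (snd v) * coeff c (snd u))"
      by (simp add: coeff_times[OF nAB sAB noetherian_supp[of c] order_refl]
          coeff_times[OF noetherian_supp[of a] order_refl noetherian_supp[of b] order_refl]
          sum_distrib_right case_prod_unfold)
    also have "\<dots> = (\<Sum>(u, v) \<in> Sigma {u. fst u \<in> ?AB \<and> snd u \<in> ?C \<and> fst u + snd u = m}
        (\<lambda>u. {v. fst v \<in> ?A \<and> snd v \<in> ?B \<and> fst v + snd v = fst u}).
            coeff a (fst v) * coeff b (snd v) * coeff c (snd u))"
      using finite_pairs[OF nAB noetherian_supp[of c]]
        finite_pairs[OF noetherian_supp[of a] noetherian_supp[of b]]
      by (subst sum.Sigma) (auto simp: case_prod_unfold)
    also have "\<dots> = (\<Sum>(u, v) \<in> Sigma {u. fst u \<in> ?A \<and> snd u \<in> ?BC \<and> fst u + snd u = m}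
        (\<lambda>u. {v. fst v \<in> ?B \<and> snd v \<in> ?C \<and> fst v + snd v = snd u}).
            coeff a (fst u) * (coeff b (fst v) * coeff c (snd v)))"
      by (rule sum.reindex_bij_witness[where
            i = "\<lambda>(u, v). ((fst u + fst v, snd v), (fst u, fst v))" and
            j = "\<lambda>(u, v). ((fst v, snd v + snd u), (snd v, snd u))"])
         (auto simp: mult.assoc, (blast | metis add.assoc)+)
    also have "\<dots> = (\<Sum>u | fst u \<in> ?A \<and> snd u \<in> ?BC \<and> fst u + snd u = m.
          \<Sum>v | fst v \<in> ?B \<and> snd v \<in> ?C \<and> fst v + snd v = snd u.
            coeff a (fst u) * (coeff b (fst v) * coeff c (snd v)))"
      using finite_pairs[OF noetherian_supp[of a] nBC]
        finite_pairs[OF noetherian_supp[of b] noetherian_supp[of c]]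
      by (subst sum.Sigma) (auto simp: case_prod_unfold)
    also have "\<dots> = coeff (a * (b * c)) m"
      by (simp add: coeff_times[OF noetherian_supp[of a] order_refl nBC sBC]
          coeff_times[OF noetherian_supp[of b] order_refl noetherian_supp[of c] order_refl]
          sum_distrib_left case_prod_unfold)
    finally show "coeff (a * b * c) m = coeff (a * (b * c)) m" .
  qed
  have one: "supp (1 :: ('a, 'b) nseries) \<subseteq> {0}" by (auto simp: supp_def one_nseries.rep_eq)
  show "1 * a = a"
  proof (rule nseries_eqI)
    fix m
    have "coeff (1 * a) m = (\<Sum>(x, y) | x \<in> {0} \<and> y \<in> ?A \<and> x + y = m. coeff 1 x * coeff a y)"
      by (rule coeff_times) (simp_all add: one)
    also have "{(x, y). x \<in> {0} \<and> y \<in> ?A \<and> x + y = m} = (if m \<in> ?A then {(0, m)} else {})"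
      by auto
    finally show "coeff (1 * a) m = coeff a m"
      by (auto simp: one_nseries.rep_eq supp_def split: if_splits)
  qed
  show "a * 1 = a"
  proof (rule nseries_eqI)
    fix m
    have "coeff (a * 1) m = (\<Sum>(x, y) | x \<in> ?A \<and> y \<in> {0} \<and> x + y = m. coeff a x * coeff 1 y)"
      by (rule coeff_times) (simp_all add: one)
    also have "{(x, y). x \<in> ?A \<and> y \<in> {0} \<and> x + y = m} = (if m \<in> ?A then {(m, 0)} else {})"
      by auto
    finally show "coeff (a * 1) m = coeff a m"
      by (auto simp: one_nseries.rep_eq supp_def split: if_splits)
  qed
  let ?ABC = "?A \<union> ?B \<union> ?C"
  have n: "noetherian ?ABC" by (simp add: noetherian_Un)
  have s: "supp (a + b) \<subseteq> ?ABC" "supp (b + c) \<subseteq> ?ABC" "?A \<subseteq> ?ABC" "?B \<subseteq> ?ABC" "?C \<subseteq> ?ABC"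
    by (auto simp: supp_def plus_nseries.rep_eq)
  show "(a + b) * c = a * c + b * c"
    by (rule nseries_eqI)
      (simp add: plus_nseries.rep_eq coeff_times[OF n s(1) n s(5)] coeff_times[OF n s(3) n s(5)]
        coeff_times[OF n s(4) n s(5)] sum.distrib[symmetric] case_prod_unfold distrib_right)
  show "a * (b + c) = a * b + a * c"
    by (rule nseries_eqI)
      (simp add: plus_nseries.rep_eq coeff_times[OF n s(3) n s(2)] coeff_times[OF n s(3) n s(4)]
        coeff_times[OF n s(3) n s(5)] sum.distrib[symmetric] case_prod_unfold distrib_left)
  show "(0 :: ('a, 'b) nseries) \<noteq> 1"
  proof
    assume "(0 :: ('a, 'b) nseries) = 1"
    then have "coeff (0 :: ('a, 'b) nseries) 0 = coeff (1 :: ('a, 'b) nseries) 0" by simp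
    then show False by (simp add: zero_nseries.rep_eq one_nseries.rep_eq)
  qed
qed

end

lemma supp_scale: "supp (scale c a) \<subseteq> supp a"
  by (auto simp: supp_def scale.rep_eq)

lemma scale_mult_left:
  fixes a b :: "('m::partially_ordered_monoid_add, 'k::field) nseries"
  shows "scale c a * b = scale c (a * b)"
  by (rule nseries_eqI)
    (simp add: scale.rep_eq coeff_times[OF noetherian_supp[of a] supp_scale noetherian_supp[of b] order_refl]
      coeff_times[OF noetherian_supp[of a] order_refl noetherian_supp[of b] order_refl]
      sum_distrib_left case_prod_unfold mult.assoc)

lemma scale_mult_right:
  fixes a b :: "('m::partially_ordered_monoid_add, 'k::field) nseries"
  shows "a * scale c b = scale c (a * b)"
  by (rule nseries_eqI)
    (simp add: scale.rep_eq coeff_times[OF noetherian_supp[of a] order_refl noetherian_supp[of b] supp_scale]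
      coeff_times[OF noetherian_supp[of a] order_refl noetherian_supp[of b] order_refl]
      sum_distrib_left case_prod_unfold mult.left_commute)

section \<open>Summable families and strongly linear maps\<close>

text \<open>A family indexed by a set \<open>I\<close> is given by a function \<open>v\<close> of which only the
  values on \<open>I\<close> matter.\<close>

definition summable_family :: "('i \<Rightarrow> ('m::order, 'k::zero) nseries) \<Rightarrow> 'i set \<Rightarrow> bool" where
  "summable_family v I \<longleftrightarrow>
     noetherian (\<Union>i\<in>I. supp (v i)) \<and> (\<forall>m. finite {i \<in> I. m \<in> supp (v i)})"

text \<open>Only meaningful for summable families: the sums are then finite, and the function is a
  Noetherian series (see \<open>coeff_family_sum\<close> below).\<close>

definition family_sum ::
    "('i \<Rightarrow> ('m::order, 'k::comm_monoid_add) nseries) \<Rightarrow> 'i set \<Rightarrow> ('m, 'k) nseries" where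
  "family_sum v I = Abs_nseries (\<lambda>m. \<Sum>i | i \<in> I \<and> m \<in> supp (v i). coeff (v i) m)"

lemma coeff_family_sum:
  assumes "summable_family v I"
  shows "coeff (family_sum v I) m = (\<Sum>i | i \<in> I \<and> m \<in> supp (v i). coeff (v i) m)"
proof -
  have "{m. (\<Sum>i | i \<in> I \<and> m \<in> supp (v i). coeff (v i) m) \<noteq> 0} \<subseteq> (\<Union>i\<in>I. supp (v i))"
    by (auto elim: sum.not_neutral_contains_not_neutral)
  then have "noetherian {m. (\<Sum>i | i \<in> I \<and> m \<in> supp (v i). coeff (v i) m) \<noteq> 0}"
    using assms noetherian_subset unfolding summable_family_def by blast
  then show ?thesis unfolding family_sum_def by (subst Abs_nseries_inverse) auto
qed

text \<open>A definition in HOL cannot quantify over families with index sets of arbitrary type.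
  Since the zero members of a summable family are irrelevant and each \<open>m\<close> lies in the support of
  finitely many members only, subsets of \<open>'m \<times> nat\<close> suffice as index sets; the lemma
  \<open>strongly_linear_family\<close> below recovers the property for all index types.\<close>

definition strongly_linear ::
    "(('m::order, 'k::field) nseries \<Rightarrow> ('m, 'k) nseries) \<Rightarrow> bool" where
  "strongly_linear \<phi> \<longleftrightarrow> Vector_Spaces.linear scale scale \<phi> \<and>
     (\<forall>(v :: 'm \<times> nat \<Rightarrow> ('m, 'k) nseries) I. summable_family v I \<longrightarrow>
        summable_family (\<phi> \<circ> v) I \<and> family_sum (\<phi> \<circ> v) I = \<phi> (family_sum v I))"

lemma family_cong_zero:
  assumes "J \<subseteq> I" "\<And>i. i \<in> I - J \<Longrightarrow> v i = 0"
  shows "summable_family v I \<longleftrightarrow> summable_family v J" "family_sum v I = family_sum v J"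
proof -
  have "{i \<in> I. m \<in> supp (v i)} = {i \<in> J. m \<in> supp (v i)}" for m
    using assms by (cases; auto) (metis DiffI empty_iff supp_zero)
  moreover have "(\<Union>i\<in>I. supp (v i)) = (\<Union>i\<in>J. supp (v i))"
    using calculation by auto
  ultimately show "summable_family v I \<longleftrightarrow> summable_family v J" "family_sum v I = family_sum v J"
    by (simp_all add: summable_family_def family_sum_def)
qed

lemma family_reindex:
  assumes "inj_on h I"
  shows "summable_family v (h ` I) \<longleftrightarrow> summable_family (v \<circ> h) I"
    "family_sum v (h ` I) = family_sum (v \<circ> h) I"
proof -
  have img: "{j \<in> h ` I. m \<in> supp (v j)} = h ` {i \<in> I. m \<in> supp (v (h i))}" for m by auto
  have inj: "inj_on h {i \<in> I. m \<in> supp (v (h i))}" for m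
    using assms by (rule inj_on_subset) auto
  show "summable_family v (h ` I) \<longleftrightarrow> summable_family (v \<circ> h) I"
    unfolding summable_family_def by (simp add: img finite_image_iff[OF inj])
  show "family_sum v (h ` I) = family_sum (v \<circ> h) I"
    unfolding family_sum_def by (simp add: img sum.reindex[OF inj])
qed

lemma strongly_linear_family:
  fixes v :: "'i \<Rightarrow> ('m::order, 'k::field) nseries"
  assumes \<phi>: "strongly_linear \<phi>" and v: "summable_family v I"
  shows "summable_family (\<phi> \<circ> v) I \<and> family_sum (\<phi> \<circ> v) I = \<phi> (family_sum v I)"
proof -
  interpret lin: Vector_Spaces.linear scale scale \<phi>
    using \<phi> by (simp add: strongly_linear_def)
  define J where "J = {i \<in> I. v i \<noteq> 0}"
  have "\<forall>i\<in>J. \<exists>m. m \<in> supp (v i)" using supp_eq_empty_iff by (fastforce simp: J_def)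
  then obtain p where p: "\<And>i. i \<in> J \<Longrightarrow> p i \<in> supp (v i)" by metis
  have "\<forall>m. \<exists>e :: 'i \<Rightarrow> nat. inj_on e {i \<in> I. m \<in> supp (v i)}"
    using v finite_imp_inj_to_nat_seg unfolding summable_family_def by metis
  then obtain e :: "'m \<Rightarrow> 'i \<Rightarrow> nat" where e: "\<And>m. inj_on (e m) {i \<in> I. m \<in> supp (v i)}" by metis
  define h where "h i = (p i, e (p i) i)" for i
  have h: "inj_on h J"
  proof (rule inj_onI)
    fix i j assume ij: "i \<in> J" "j \<in> J" "h i = h j"
    then show "i = j" using p[of i] p[of j] inj_onD[OF e[of "p i"], of i j] by (auto simp: h_def J_def)
  qed
  define w where "w = v \<circ> inv_into J h"
  have eq: "(w \<circ> h) i = v i" if "i \<in> J" for i using that h by (simp add: w_def)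
  have cong: "summable_family f J = summable_family g J" "family_sum f J = family_sum g J"
    if "\<And>i. i \<in> J \<Longrightarrow> f i = g i" for f g :: "'i \<Rightarrow> ('m, 'k) nseries"
  proof -
    have "{i \<in> J. m \<in> supp (f i)} = {i \<in> J. m \<in> supp (g i)}" for m using that by auto
    moreover have "(\<Union>i\<in>J. supp (f i)) = (\<Union>i\<in>J. supp (g i))" using that by auto
    moreover have "(\<Sum>i | i \<in> J \<and> m \<in> supp (f i). coeff (f i) m) =
        (\<Sum>i | i \<in> J \<and> m \<in> supp (g i). coeff (g i) m)" for m
      using that by (intro sum.cong) auto
    ultimately show "summable_family f J = summable_family g J" "family_sum f J = family_sum g J"
      by (simp_all add: summable_family_def family_sum_def)
  qed
  have v0: "v i = 0" "(\<phi> \<circ> v) i = 0" if "i \<in> I - J" for i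
    using that lin.zero by (auto simp: J_def)
  have JI: "J \<subseteq> I" by (auto simp: J_def)
  note zv = family_cong_zero[of J I v, OF JI v0(1)]
  note z\<phi> = family_cong_zero[of J I "\<phi> \<circ> v", OF JI v0(2)]
  have "summable_family (w \<circ> h) J" "family_sum (w \<circ> h) J = family_sum v I"
    using v zv cong[of "w \<circ> h" v, OF eq] by (simp_all only:)
  then have w: "summable_family w (h ` J)" "family_sum w (h ` J) = family_sum v I"
    by (simp_all only: family_reindex[OF h])
  then have "summable_family (\<phi> \<circ> w) (h ` J)" "family_sum (\<phi> \<circ> w) (h ` J) = \<phi> (family_sum v I)"
    using \<phi> unfolding strongly_linear_def by auto
  then have "summable_family (\<phi> \<circ> w \<circ> h) J" "family_sum (\<phi> \<circ> w \<circ> h) J = \<phi> (family_sum v I)"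
    by (simp_all only: family_reindex[OF h])
  moreover have "(\<phi> \<circ> w \<circ> h) i = (\<phi> \<circ> v) i" if "i \<in> J" for i using eq[OF that] by simp
  ultimately show ?thesis
    using z\<phi> cong[of "\<phi> \<circ> w \<circ> h" "\<phi> \<circ> v"] by (simp only:)
qed

section \<open>The group of automorphisms\<close>

definition precedes ::
    "('m::order, 'k::ab_group_add) nseries \<Rightarrow> ('m, 'k) nseries \<Rightarrow> bool" where
  "precedes v w \<longleftrightarrow> w \<noteq> 0 \<and> (\<forall>p\<in>supp v. \<exists>q\<in>supp w. p > q)"

definition algebra_morphism ::
    "(('m::partially_ordered_monoid_add, 'k::field) nseries \<Rightarrow> ('m, 'k) nseries) \<Rightarrow> bool" where
  "algebra_morphism \<sigma> \<longleftrightarrow> Vector_Spaces.linear scale scale \<sigma> \<and>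
     (\<forall>a b. \<sigma> (a * b) = \<sigma> a * \<sigma> b) \<and> \<sigma> 1 = 1"

definition one_aut_plus ::
    "(('m::partially_ordered_monoid_add, 'k::field) nseries \<Rightarrow> ('m, 'k) nseries) monoid" where
  "one_aut_plus =
     \<lparr>carrier = {\<sigma>. bij \<sigma> \<and> strongly_linear \<sigma> \<and> algebra_morphism \<sigma> \<and> (\<forall>a. a \<noteq> 0 \<longrightarrow> precedes (\<sigma> a - a) a)},
      monoid.mult = (\<circ>), one = id\<rparr>"

definition divisible :: "('a, 'b) monoid_scheme \<Rightarrow> bool" where
  "divisible G \<longleftrightarrow> (\<forall>n::nat. n \<ge> 1 \<longrightarrow> (\<forall>x\<in>carrier G. \<exists>y\<in>carrier G. x = y [^]\<^bsub>G\<^esub> n))"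

definition torsion_free :: "('a, 'b) monoid_scheme \<Rightarrow> bool" where
  "torsion_free G \<longleftrightarrow>
     (\<forall>x\<in>carrier G. \<forall>n::nat. n \<ge> 1 \<longrightarrow> x [^]\<^bsub>G\<^esub> n = \<one>\<^bsub>G\<^esub> \<longrightarrow> x = \<one>\<^bsub>G\<^esub>)"

end

theory Submission
  imports "HOL-Computational_Algebra.Polynomial" "HOL-Computational_Algebra.Formal_Power_Series" Defs
begin

text \<open>
  Write an element of the group as \<open>\<sigma> = id + \<delta>\<close>. The operator \<open>\<delta>\<close> is strongly linear and pushes
  supports strictly upwards. The idea is to give a meaning to \<open>\<sigma>\<close> to the power \<open>c\<close> for every scalar
  \<open>c\<close>, by the binomial series \<open>\<Sum>n. (c gchoose n) \<delta>\<^sup>n\<close> (\<open>scalar_power\<close> below). The powers satisfy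
  the exponent law, so that inverses are powers with exponent \<open>- 1\<close> and \<open>n\<close>-th roots are powers with
  exponent \<open>1 / n\<close>.

  The binomial series makes sense because \<open>\<delta>\<close> can be iterated: starting from a Noetherian set of
  exponents, the set of all exponents that can be reached by applying \<open>\<delta>\<close> any number of times is
  Noetherian (\<open>noetherian_rtrancl_Image\<close>, a minimal bad sequence argument), and the number of
  iterations after which a given exponent can be reached is bounded (\<open>finite_levels\<close>). Every coefficient of a power series in
  \<open>\<delta>\<close> is therefore given by a finite sum, whose length depends only on the exponent and on a bound
  for the support of the argument (\<open>absorbing_superset\<close>). This reduces strong linearity and the rule
  for composition to computations with finite sums.

  That the powers are multiplicative can be seen without logarithms and derivations. A fixed
  coefficient of \<open>scalar_power c a\<close> is a polynomial in \<open>c\<close>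
  (\<open>coeff_scalar_power_polynomial\<close>). Thus an identity between such coefficients holds for all \<open>c\<close> as
  soon as it holds for the natural numbers, where \<open>scalar_power\<close> is the iteration of \<open>\<sigma>\<close>; here the
  characteristic has to be zero. The same principle gives torsion-freeness: if \<open>\<sigma>\<close> has finite order
  \<open>n\<close>, then \<open>scalar_power c a = a\<close> for all multiples \<open>c\<close> of \<open>n\<close>, hence for \<open>c = 1\<close>.
\<close>

section \<open>Noetherian sets and increasing relations\<close>

lemma noetherian_seq_good:
  fixes s :: "nat \<Rightarrow> 'a::order"
  assumes "noetherian S" "\<And>n. s n \<in> S"
  shows "\<exists>i j. i < j \<and> s i \<le> s j"
proof -
  obtain r :: "nat \<Rightarrow> nat" where r: "strict_mono r" "mono (s \<circ> r)"
    using assms by (rule noetherian_mono_subseq)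
  have "r 0 < r 1" using r(1) by (simp add: strict_mono_less)
  moreover have "s (r 0) \<le> s (r 1)" using monoD[OF r(2), of 0 1] by simp
  ultimately show ?thesis by blast
qed

lemma wf_less_on_noetherian:
  fixes T :: "'a::order set"
  assumes "noetherian T"
  shows "wf {(x, y). x \<in> T \<and> y \<in> T \<and> x < y}"
  unfolding wf_iff_no_infinite_down_chain
proof
  assume "\<exists>s. \<forall>i. (s (Suc i), s i) \<in> {(x, y). x \<in> T \<and> y \<in> T \<and> x < y}"
  then obtain s where s: "\<And>i. s i \<in> T" "\<And>i. s (Suc i) < s i" by auto
  from noetherian_seq_good[OF assms s(1)] obtain i j where ij: "i < j" "s i \<le> s j" by blast
  have "s j < s i" using ij(1) s(2)
    by (induction j) (auto simp: less_Suc_eq dest: less_trans[where 'a = 'a])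
  with ij(2) show False by simp
qed

text \<open>Among all sequences with the property \<open>B\<close> choose one whose terms minimise \<open>d\<close> successively, each
  term given the previous ones. The limit of this process keeps the property because \<open>B\<close> can be
  verified on finite prefixes.\<close>

lemma minimal_bad_sequence:
  fixes d :: "'a \<Rightarrow> nat" and B :: "(nat \<Rightarrow> 'a) \<Rightarrow> bool"
  assumes B: "B b"
    and lim: "\<And>f. (\<And>n. \<exists>s. B s \<and> (\<forall>i<n. s i = f i)) \<Longrightarrow> B f"
  obtains f where "B f" "\<forall>t n. B t \<longrightarrow> (\<forall>i<n. t i = f i) \<longrightarrow> d (f n) \<le> d (t n)"
proof -
  define minimal where "minimal n s \<longleftrightarrow>
    B s \<and> (\<forall>t. B t \<longrightarrow> (\<forall>i<n. t i = s i) \<longrightarrow> d (s n) \<le> d (t n))" for n s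
  have next_ex: "\<exists>t. minimal n t \<and> (\<forall>i<n. t i = s i)" if "B s" for s n
  proof -
    let ?Q = "\<lambda>t. B t \<and> (\<forall>i<n. t i = s i)"
    have "?Q s" using that by simp
    from ex_has_least_nat[of ?Q, OF this, of "\<lambda>t. d (t n)"]
    obtain t where "?Q t" "\<And>u. ?Q u \<Longrightarrow> d (t n) \<le> d (u n)" by blast
    then show ?thesis unfolding minimal_def by (intro exI[of _ t]) auto
  qed
  have "\<exists>s. \<forall>n. minimal n (s n) \<and> (\<forall>i<Suc n. s (Suc n) i = s n i)"
  proof (rule dependent_nat_choice)
    show "\<exists>s. minimal 0 s" using next_ex[OF B, of 0] by blast
    show "\<exists>t. minimal (Suc n) t \<and> (\<forall>i<Suc n. t i = s i)" if "minimal n s" for s n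
      using that next_ex[of s "Suc n"] unfolding minimal_def by blast
  qed
  then obtain s where s: "\<And>n. minimal n (s n)"
    and step: "\<And>n i. i < Suc n \<Longrightarrow> s (Suc n) i = s n i" by blast
  define f where "f n = s n n" for n
  have agree: "s n i = f i" if "i \<le> n" for i n
    using that by (induction n) (auto simp: f_def step le_Suc_eq)
  have "B f"
  proof (rule lim)
    show "\<exists>t. B t \<and> (\<forall>i<n. t i = f i)" for n
      using s[of n] agree[of _ n] unfolding minimal_def by (intro exI[of _ "s n"]) auto
  qed
  moreover have "d (f n) \<le> d (t n)" if "B t" "\<forall>i<n. t i = f i" for t n
  proof -
    have "\<forall>i<n. t i = s n i" using that(2) agree[of _ n] by simp
    with s[of n] that(1) show ?thesis unfolding minimal_def f_def by blast
  qed
  ultimately show ?thesis using that by blast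
qed

text \<open>Nash-Williams' argument. Let \<open>d\<close> measure the number of \<open>R\<close>-steps needed to reach a point from
  \<open>S\<close>, and take a sequence without increasing pairs that is minimal for \<open>d\<close>. Its terms outside \<open>S\<close> have
  \<open>R\<close>-predecessors with smaller \<open>d\<close>. As predecessors lie below, a bad sequence of predecessors could
  replace a tail of the minimal one; so the predecessors form a Noetherian set. By the hypothesis on
  \<open>R\<close> the terms themselves then lie in a Noetherian set, which is absurd.\<close>

lemma noetherian_rtrancl_Image:
  fixes R :: "('a::order \<times> 'a) set"
  assumes inc: "\<And>x y. (x, y) \<in> R \<Longrightarrow> x < y"
    and step: "\<And>S. noetherian S \<Longrightarrow> noetherian (R `` S)"
    and S: "noetherian S"
  shows "noetherian (R\<^sup>* `` S)"
proof (rule ccontr)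
  assume not: "\<not> noetherian (R\<^sup>* `` S)"
  define B where "B s \<longleftrightarrow> (\<forall>n. s n \<in> R\<^sup>* `` S) \<and> (\<forall>i j. i < j \<longrightarrow> \<not> s i \<le> s j)"
    for s :: "nat \<Rightarrow> 'a"
  define d where "d x = (LEAST n. x \<in> (R ^^ n) `` S)" for x
  from not noetherianI_seq[of "R\<^sup>* `` S"] obtain b where "B b" unfolding B_def by blast
  moreover have "B f" if f: "\<And>n. \<exists>s. B s \<and> (\<forall>i<n. s i = f i)" for f
    unfolding B_def
  proof (intro conjI allI impI)
    show "f n \<in> R\<^sup>* `` S" for n using f[of "Suc n"] unfolding B_def by (metis lessI)
    show "\<not> f i \<le> f j" if "i < j" for i j
      using f[of "Suc j"] that unfolding B_def by (metis lessI less_trans)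
  qed
  ultimately obtain f where f: "B f"
    and min: "\<forall>t n. B t \<longrightarrow> (\<forall>i<n. t i = f i) \<longrightarrow> d (f n) \<le> d (t n)"
    by (rule minimal_bad_sequence[where d = d])
  have fT: "f n \<in> R\<^sup>* `` S" and bad: "i < j \<Longrightarrow> \<not> f i \<le> f j" for n i j
    using f unfolding B_def by auto
  have pred: "f n \<in> S \<or> (\<exists>u. u \<in> R\<^sup>* `` S \<and> (u, f n) \<in> R \<and> d u < d (f n))" for n
  proof -
    have "\<exists>k. f n \<in> (R ^^ k) `` S" using fT[of n] rtrancl_imp_relpow by fast
    then have k: "f n \<in> (R ^^ d (f n)) `` S" unfolding d_def by (rule LeastI_ex)
    show ?thesis
    proof (cases "d (f n)")
      case 0
      with k show ?thesis by auto
    next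
      case (Suc l)
      with k obtain x u where u: "x \<in> S" "(x, u) \<in> R ^^ l" "(u, f n) \<in> R" by auto
      then have "d u \<le> l" unfolding d_def by (intro Least_le) auto
      moreover have "u \<in> R\<^sup>* `` S" using u(1,2) relpow_imp_rtrancl by blast
      ultimately show ?thesis using u(3) Suc by auto
    qed
  qed
  let ?N = "{n. f n \<notin> S}"
  obtain u where u: "\<And>n. n \<in> ?N \<Longrightarrow> u n \<in> R\<^sup>* `` S \<and> (u n, f n) \<in> R \<and> d (u n) < d (f n)"
    using pred by (metis mem_Collect_eq)
  have "noetherian (u ` ?N)"
  proof (rule noetherianI_seq)
    fix s :: "nat \<Rightarrow> 'a" assume "\<And>n. s n \<in> u ` ?N"
    then have "\<forall>n. \<exists>i. i \<in> ?N \<and> s n = u i" by blast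
    then obtain i where i: "\<And>n. i n \<in> ?N" "\<And>n. s n = u (i n)" by metis
    \<comment> \<open>The replaced tail starts at the least index that occurs, so that every \<open>u (i n)\<close> lies below a
      term of \<open>f\<close> behind the retained prefix.\<close>
    obtain k where k: "\<And>n. i k \<le> i n"
      using ex_has_least_nat[of "\<lambda>_::nat. True" 0 i] by auto
    define t where "t n = (if n < i k then f n else s (k + (n - i k)))" for n
    have "t (i k) = u (i k)" by (simp add: t_def i)
    then have "\<not> d (f (i k)) \<le> d (t (i k))" using u[OF i(1)[of k]] by simp
    moreover have "\<forall>j<i k. t j = f j" by (simp add: t_def)
    ultimately have "\<not> B t" using min by blast
    moreover have "t n \<in> R\<^sup>* `` S" for n using fT u i by (simp add: t_def)
    ultimately obtain p q where pq: "p < q" "t p \<le> t q" unfolding B_def by blast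
    show "\<exists>i j. i < j \<and> s i \<le> s j"
    proof (cases "p < i k")
      case True
      show ?thesis
      proof (cases "q < i k")
        case True
        with \<open>p < i k\<close> pq bad[OF pq(1)] show ?thesis by (simp add: t_def)
      next
        case False
        let ?n = "i (k + (q - i k))"
        have "f p \<le> u ?n" using True False pq i by (simp add: t_def)
        also have "u ?n < f ?n" using u i inc by blast
        finally have "f p \<le> f ?n" by simp
        moreover have "p < ?n" using True k less_le_trans by blast
        ultimately show ?thesis using bad by blast
      qed
    next
      case False
      with pq have "k + (p - i k) < k + (q - i k)" "s (k + (p - i k)) \<le> s (k + (q - i k))"
        by (simp_all add: t_def)
      then show ?thesis by blast
    qed
  qed
  then have "noetherian (S \<union> R `` (u ` ?N))" by (intro noetherian_Un S step)
  moreover have "f n \<in> S \<union> R `` (u ` ?N)" for n using u[of n] by blast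
  ultimately show False using noetherian_seq_good bad by blast
qed

text \<open>Koenig's lemma for the tree of \<open>R\<close>-paths that end in \<open>y\<close>: it branches finitely, and its paths
  descend in a well-founded set.\<close>

lemma finite_levels:
  fixes R :: "('a::order \<times> 'a) set"
  assumes inc: "\<And>x y. (x, y) \<in> R \<Longrightarrow> x < y"
    and T: "noetherian T" "R `` T \<subseteq> T"
    and fin: "\<And>y. finite {x \<in> T. (x, y) \<in> R}"
  shows "finite {n. y \<in> (R ^^ n) `` T}"
proof -
  have RnT: "(R ^^ n) `` T \<subseteq> T" for n using T(2) by (induction n) auto
  have "finite {n. y \<in> (R ^^ n) `` T}" if "y \<in> T" for y
    using that
  proof (induction y rule: wf_induct_rule[OF wf_less_on_noetherian[OF T(1)]])
    case (1 y)
    have "{n. y \<in> (R ^^ n) `` T} \<subseteq>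
        {0} \<union> (\<Union>x\<in>{x \<in> T. (x, y) \<in> R}. Suc ` {n. x \<in> (R ^^ n) `` T})"
    proof
      fix n assume n: "n \<in> {n. y \<in> (R ^^ n) `` T}"
      show "n \<in> {0} \<union> (\<Union>x\<in>{x \<in> T. (x, y) \<in> R}. Suc ` {n. x \<in> (R ^^ n) `` T})"
      proof (cases n)
        case (Suc l)
        with n obtain x where "x \<in> (R ^^ l) `` T" "(x, y) \<in> R" by auto
        with RnT[of l] Suc show ?thesis by blast
      qed simp
    qed
    moreover have "finite \<dots>" using fin 1 inc by (intro finite_UnI finite_UN_I finite_imageI) auto
    ultimately show ?case by (rule finite_subset)
  qed
  moreover have "{n. y \<in> (R ^^ n) `` T} = {}" if "y \<notin> T" using that RnT by blast
  ultimately show ?thesis by (cases "y \<in> T") (assumption | simp)+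
qed

section \<open>Families and strongly linear maps\<close>

lemma supp_family_sum:
  assumes "summable_family v I"
  shows "supp (family_sum v I) \<subseteq> (\<Union>i\<in>I. supp (v i))"
  by (auto simp: supp_def[of "family_sum v I"] coeff_family_sum[OF assms]
      elim: sum.not_neutral_contains_not_neutral)

lemma coeff_family_sum_superset:
  assumes "summable_family v I" "finite J" "{i \<in> I. m \<in> supp (v i)} \<subseteq> J" "J \<subseteq> I"
  shows "coeff (family_sum v I) m = (\<Sum>i\<in>J. coeff (v i) m)"
  unfolding coeff_family_sum[OF assms(1)]
  by (rule sum.mono_neutral_left) (use assms in \<open>auto simp: supp_def\<close>)

lemma coeff_add [simp]: "coeff (a + b) m = coeff a m + coeff b m"
  by (simp add: plus_nseries.rep_eq)

lemma coeff_diff [simp]: "coeff (a - b) m = coeff a m - coeff b m"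
  by (simp add: minus_nseries.rep_eq)

lemma coeff_zero [simp]: "coeff 0 m = 0"
  by (simp add: zero_nseries.rep_eq)

lemma coeff_scale [simp]: "coeff (scale c a) m = c * coeff a m"
  by (simp add: scale.rep_eq)

lemma linear_scaleI:
  fixes \<phi> :: "('m::order, 'k::field) nseries \<Rightarrow> ('m, 'k) nseries"
  assumes "\<And>a b. \<phi> (a + b) = \<phi> a + \<phi> b" "\<And>c a. \<phi> (scale c a) = scale c (\<phi> a)"
  shows "Vector_Spaces.linear scale scale \<phi>"
  using assms vector_space_scale
  by (auto simp: Vector_Spaces.linear_iff module_hom_iff vector_space_def module_def)

lemma strongly_linear_add:
  "strongly_linear \<phi> \<Longrightarrow> \<phi> (a + b) = \<phi> a + \<phi> b"
  and strongly_linear_scale: "strongly_linear \<phi> \<Longrightarrow> \<phi> (scale c a) = scale c (\<phi> a)"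
  unfolding strongly_linear_def
  by (auto dest: Vector_Spaces.linear.axioms simp: Vector_Spaces.linear_iff)

lemma strongly_linear_zero: "strongly_linear \<phi> \<Longrightarrow> \<phi> 0 = 0"
  using strongly_linear_add[of \<phi> 0 0] by simp

lemma strongly_linear_id: "strongly_linear id"
  unfolding strongly_linear_def by (auto intro!: linear_scaleI)

lemma strongly_linear_comp:
  assumes "strongly_linear \<phi>" "strongly_linear \<psi>"
  shows "strongly_linear (\<phi> \<circ> \<psi>)"
  unfolding strongly_linear_def
proof (intro conjI allI impI)
  show "Vector_Spaces.linear scale scale (\<phi> \<circ> \<psi>)"
    by (rule linear_scaleI) (simp_all add: assms strongly_linear_add strongly_linear_scale)
  fix v I assume "summable_family (v :: 'a \<times> nat \<Rightarrow> ('a, 'b) nseries) I"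
  note 1 = strongly_linear_family[OF assms(2) this]
  note 2 = strongly_linear_family[OF assms(1) conjunct1[OF 1]]
  show "summable_family (\<phi> \<circ> \<psi> \<circ> v) I" "family_sum (\<phi> \<circ> \<psi> \<circ> v) I = (\<phi> \<circ> \<psi>) (family_sum v I)"
    using 1 2 by (simp_all add: comp_assoc)
qed

lemma strongly_linear_funpow: "strongly_linear \<phi> \<Longrightarrow> strongly_linear (\<phi> ^^ n)"
  by (induction n) (simp_all add: strongly_linear_id strongly_linear_comp)

lemma strongly_linear_minus_id:
  assumes \<phi>: "strongly_linear \<phi>"
  shows "strongly_linear (\<lambda>a. \<phi> a - a)"
  unfolding strongly_linear_def
proof (intro conjI allI impI)
  show "Vector_Spaces.linear scale scale (\<lambda>a. \<phi> a - a)"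
    by (rule linear_scaleI)
      (auto simp: strongly_linear_add[OF \<phi>] strongly_linear_scale[OF \<phi>] algebra_simps intro: nseries_eqI)
  fix v I assume v: "summable_family (v :: 'a \<times> nat \<Rightarrow> ('a, 'b) nseries) I"
  note w = strongly_linear_family[OF \<phi> v]
  have sub: "supp (\<phi> (v i) - v i) \<subseteq> supp ((\<phi> \<circ> v) i) \<union> supp (v i)" for i
    by (auto simp: supp_def)
  have fin: "finite ({i \<in> I. m \<in> supp ((\<phi> \<circ> v) i)} \<union> {i \<in> I. m \<in> supp (v i)})" (is "finite (?J m)") for m
    using v w unfolding summable_family_def by blast
  have "noetherian ((\<Union>i\<in>I. supp ((\<phi> \<circ> v) i)) \<union> (\<Union>i\<in>I. supp (v i)))"
    using v w unfolding summable_family_def by (intro noetherian_Un) auto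
  then have "noetherian (\<Union>i\<in>I. supp (\<phi> (v i) - v i))"
    by (rule noetherian_subset) (use sub in blast)
  moreover have J: "{i \<in> I. m \<in> supp (\<phi> (v i) - v i)} \<subseteq> ?J m" for m using sub by blast
  ultimately show s: "summable_family ((\<lambda>a. \<phi> a - a) \<circ> v) I"
    using finite_subset[OF J fin] by (simp add: summable_family_def)
  show "family_sum ((\<lambda>a. \<phi> a - a) \<circ> v) I = \<phi> (family_sum v I) - family_sum v I"
  proof (rule nseries_eqI)
    fix m
    have "coeff (family_sum ((\<lambda>a. \<phi> a - a) \<circ> v) I) m = (\<Sum>i\<in>?J m. coeff (\<phi> (v i) - v i) m)"
      using s fin J by (subst coeff_family_sum_superset[where J = "?J m"]) auto
    also have "\<dots> = (\<Sum>i\<in>?J m. coeff ((\<phi> \<circ> v) i) m) - (\<Sum>i\<in>?J m. coeff (v i) m)"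
      by (simp add: sum_subtractf)
    also have "\<dots> = coeff (family_sum (\<phi> \<circ> v) I) m - coeff (family_sum v I) m"
      using v w fin by (subst (1 2) coeff_family_sum_superset[where J = "?J m"]) auto
    finally show "coeff (family_sum ((\<lambda>a. \<phi> a - a) \<circ> v) I) m = coeff (\<phi> (family_sum v I) - family_sum v I) m"
      using w by simp
  qed
qed

section \<open>Monomials\<close>

lift_definition monomial :: "'m::order \<Rightarrow> ('m, 'k::zero_neq_one) nseries"
  is "\<lambda>u m. if m = u then 1 else 0"
  by (rule noetherian_subset[OF noetherian_singleton]) auto

lemma supp_monomial [simp]: "supp (monomial u :: ('m::order, 'k::zero_neq_one) nseries) = {u}"
  by (auto simp: supp_def monomial.rep_eq)

lemma summable_family_monomials:
  assumes "noetherian S"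
  shows "summable_family (\<lambda>u. monomial u :: ('m::order, 'k::zero_neq_one) nseries) S"
  using assms by (simp add: summable_family_def)

lemma monomial_expansion:
  fixes a :: "('m::order, 'k::field) nseries"
  shows "summable_family (\<lambda>u. scale (coeff a u) (monomial u)) (supp a)"
    and "family_sum (\<lambda>u. scale (coeff a u) (monomial u)) (supp a) = a"
proof -
  have *: "supp (scale (coeff a u) (monomial u)) = {u} \<inter> supp a" for u
    by (auto simp: supp_def monomial.rep_eq)
  show s: "summable_family (\<lambda>u. scale (coeff a u) (monomial u)) (supp a)"
    by (simp add: summable_family_def * noetherian_subset[OF noetherian_supp[of a]])
  show "family_sum (\<lambda>u. scale (coeff a u) (monomial u)) (supp a) = a"
  proof (rule nseries_eqI)
    fix m
    have "{u \<in> supp a. m \<in> {u} \<inter> supp a} = (if m \<in> supp a then {m} else {})" by auto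
    then show "coeff (family_sum (\<lambda>u. scale (coeff a u) (monomial u)) (supp a)) m = coeff a m"
      unfolding coeff_family_sum[OF s] * by (simp add: monomial.rep_eq) (simp add: supp_def)
  qed
qed

text \<open>A strongly linear map is determined by its values on monomials, and so is the spread of supports
  under it. Hence the iterates of the map can be followed through a relation between exponents.\<close>

lemma supp_strongly_linear:
  fixes \<phi> :: "('m::order, 'k::field) nseries \<Rightarrow> ('m, 'k) nseries"
  assumes "strongly_linear \<phi>"
  shows "supp (\<phi> a) \<subseteq> (\<Union>u\<in>supp a. supp (\<phi> (monomial u)))"
proof -
  note w = strongly_linear_family[OF assms monomial_expansion(1)[of a]]
  have "supp (\<phi> a) \<subseteq> (\<Union>u\<in>supp a. supp ((\<phi> \<circ> (\<lambda>u. scale (coeff a u) (monomial u))) u))"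
    using supp_family_sum[OF conjunct1[OF w]] w by (simp add: monomial_expansion(2))
  also have "\<dots> \<subseteq> (\<Union>u\<in>supp a. supp (\<phi> (monomial u)))"
    using supp_scale by (fastforce simp: strongly_linear_scale[OF assms])
  finally show ?thesis .
qed

section \<open>Power series in a contracting operator\<close>

definition operator_series ::
    "(('m::order, 'k::field) nseries \<Rightarrow> ('m, 'k) nseries) \<Rightarrow> (nat \<Rightarrow> 'k) \<Rightarrow> ('m, 'k) nseries \<Rightarrow> ('m, 'k) nseries"
  where "operator_series \<delta> f a = family_sum (\<lambda>n. scale (f n) ((\<delta> ^^ n) a)) UNIV"

locale contracting =
  fixes \<delta> :: "('m::order, 'k::field) nseries \<Rightarrow> ('m, 'k) nseries"
  assumes strongly_linear: "strongly_linear \<delta>"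
    and contracts: "p \<in> supp (\<delta> a) \<Longrightarrow> \<exists>q\<in>supp a. q < p"
begin

text \<open>On an absorbing set \<open>T\<close> the iteration of \<open>\<delta>\<close> is locally finite, uniformly in the series: only
  the first \<open>K m\<close> iterates of a series supported in \<open>T\<close> can contribute to the exponent \<open>m\<close>. The
  uniformity is what allows one to interchange sums over families with sums over iterates.\<close>

definition absorbing :: "'m set \<Rightarrow> ('m \<Rightarrow> nat) \<Rightarrow> bool" where
  "absorbing T K \<longleftrightarrow> noetherian T \<and>
     (\<forall>a n. supp a \<subseteq> T \<longrightarrow> supp ((\<delta> ^^ n) a) \<subseteq> T) \<and>
     (\<forall>a m n. supp a \<subseteq> T \<longrightarrow> n \<ge> K m \<longrightarrow> coeff ((\<delta> ^^ n) a) m = 0)"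

lemma
  assumes "absorbing T K"
  shows absorbing_noetherian: "noetherian T"
    and supp_funpow_absorbing: "supp a \<subseteq> T \<Longrightarrow> supp ((\<delta> ^^ n) a) \<subseteq> T"
    and coeff_funpow_absorbing: "supp a \<subseteq> T \<Longrightarrow> n \<ge> K m \<Longrightarrow> coeff ((\<delta> ^^ n) a) m = 0"
  using assms unfolding absorbing_def by blast+

text \<open>Let \<open>R\<close> relate \<open>u\<close> to the exponents that \<open>\<delta>\<close> produces from the monomial at \<open>u\<close>. Applying strong
  linearity to the family of monomials with exponents in a Noetherian set shows that \<open>R\<close> preserves
  Noetherian sets and is finite-to-one on them, and contraction says that \<open>R\<close> is increasing. So the
  set of exponents reachable from \<open>S\<close> is absorbing.\<close>

lemma absorbing_superset:
  assumes "noetherian S"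
  obtains T K where "S \<subseteq> T" "absorbing T K"
proof -
  define R where "R = {(u, p). p \<in> supp (\<delta> (monomial u))}"
  have inc: "x < y" if "(x, y) \<in> R" for x y
    using that contracts[of y "monomial x"] by (auto simp: R_def)
  have summ: "summable_family (\<delta> \<circ> monomial) U" if "noetherian U" for U
    using strongly_linear_family[OF strongly_linear summable_family_monomials[OF that]] by (simp add: comp_def)
  have Rim: "R `` U = (\<Union>u\<in>U. supp ((\<delta> \<circ> monomial) u))" for U by (auto simp: R_def)
  have step: "noetherian (R `` U)" if "noetherian U" for U
    using summ[OF that] unfolding Rim summable_family_def by blast
  have fin: "finite {x \<in> U. (x, y) \<in> R}" if "noetherian U" for U y
    using summ[OF that] by (simp add: R_def summable_family_def)
  define T where "T = R\<^sup>* `` S"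
  have T: "noetherian T" unfolding T_def by (rule noetherian_rtrancl_Image[OF inc step assms])
  have RT: "R `` T \<subseteq> T" by (auto simp: T_def intro: rtrancl_into_rtrancl)
  have pow: "supp ((\<delta> ^^ n) a) \<subseteq> (R ^^ n) `` supp a" for n a
  proof (induction n)
    case (Suc n)
    have "supp ((\<delta> ^^ Suc n) a) \<subseteq> R `` supp ((\<delta> ^^ n) a)"
      using supp_strongly_linear[OF strongly_linear, of "(\<delta> ^^ n) a"] by (simp add: Rim)
    also have "\<dots> \<subseteq> R `` ((R ^^ n) `` supp a)" using Suc by blast
    finally show ?case by (simp add: relcomp_Image)
  qed simp
  have RnT: "(R ^^ n) `` T \<subseteq> T" for n using RT by (induction n) auto
  have "\<exists>K. \<forall>n\<ge>K. m \<notin> (R ^^ n) `` T" for m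
    using finite_levels[OF inc T RT fin[OF T], of m]
    by (auto simp: finite_nat_set_iff_bounded not_le[symmetric])
  then obtain K where K: "\<And>m n. n \<ge> K m \<Longrightarrow> m \<notin> (R ^^ n) `` T" by metis
  have "supp ((\<delta> ^^ n) a) \<subseteq> T" if "supp a \<subseteq> T" for a n
    using pow[of n a] RnT[of n] that by blast
  moreover have "coeff ((\<delta> ^^ n) a) m = 0" if "supp a \<subseteq> T" "n \<ge> K m" for a n m
  proof -
    have "m \<notin> supp ((\<delta> ^^ n) a)" using pow[of n a] K[OF that(2)] that(1) by blast
    then show ?thesis by (simp add: supp_def)
  qed
  ultimately have "absorbing T K" using T unfolding absorbing_def by blast
  moreover have "S \<subseteq> T" by (auto simp: T_def)
  ultimately show ?thesis using that by blast
qed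

lemma summable_operator_series: "summable_family (\<lambda>n. scale (f n) ((\<delta> ^^ n) a)) UNIV"
proof -
  obtain T K where T: "supp a \<subseteq> T" "absorbing T K"
    using absorbing_superset[OF noetherian_supp[of a]] by blast
  have "(\<Union>n. supp (scale (f n) ((\<delta> ^^ n) a))) \<subseteq> T"
    using supp_scale supp_funpow_absorbing[OF T(2,1)] by (meson UN_least subset_trans)
  then have "noetherian (\<Union>n. supp (scale (f n) ((\<delta> ^^ n) a)))"
    by (rule noetherian_subset[OF absorbing_noetherian[OF T(2)]])
  moreover have "{n. m \<in> supp (scale (f n) ((\<delta> ^^ n) a))} \<subseteq> {..<K m}" for m
    using coeff_funpow_absorbing[OF T(2,1)] by (auto simp: supp_def not_le[symmetric])
  then have "finite {n. m \<in> supp (scale (f n) ((\<delta> ^^ n) a))}" for m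
    by (rule finite_subset) simp
  ultimately show ?thesis by (simp add: summable_family_def)
qed

lemma coeff_operator_series:
  assumes "\<And>n. n \<ge> K \<Longrightarrow> coeff ((\<delta> ^^ n) a) m = 0"
  shows "coeff (operator_series \<delta> f a) m = (\<Sum>n<K. f n * coeff ((\<delta> ^^ n) a) m)"
proof -
  have "{n \<in> UNIV. m \<in> supp (scale (f n) ((\<delta> ^^ n) a))} \<subseteq> {..<K}"
    using assms by (force simp: supp_def not_le[symmetric])
  from coeff_family_sum_superset[OF summable_operator_series _ this]
  show ?thesis by (simp add: operator_series_def)
qed

lemma coeff_operator_series_absorbing:
  assumes "absorbing T K" "supp a \<subseteq> T"
  shows "coeff (operator_series \<delta> f a) m = (\<Sum>n<K m. f n * coeff ((\<delta> ^^ n) a) m)"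
  using coeff_funpow_absorbing[OF assms] by (rule coeff_operator_series)

lemma supp_operator_series_absorbing:
  assumes "absorbing T K" "supp a \<subseteq> T"
  shows "supp (operator_series \<delta> f a) \<subseteq> T"
  using supp_family_sum[OF summable_operator_series[of f a]] supp_scale supp_funpow_absorbing[OF assms]
  unfolding operator_series_def by blast

text \<open>All members of a summable family are supported in one absorbing set, so that at each exponent the
  operator is the same finite combination of the strongly linear iterates of \<open>\<delta>\<close>.\<close>

lemma strongly_linear_operator_series: "strongly_linear (operator_series \<delta> f)"
  unfolding strongly_linear_def
proof (intro conjI allI impI)
  note sl = strongly_linear_funpow[OF strongly_linear]
  show "Vector_Spaces.linear scale scale (operator_series \<delta> f)"
  proof (intro linear_scaleI nseries_eqI)
    fix a b :: "('m, 'k) nseries" and c m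
    have "noetherian (supp a \<union> supp b)" by (intro noetherian_Un) auto
    then obtain T K where T: "supp a \<union> supp b \<subseteq> T" "absorbing T K" by (rule absorbing_superset)
    note coeff = coeff_operator_series_absorbing[OF T(2)]
    have "supp (a + b) \<subseteq> supp a \<union> supp b" by (auto simp: supp_def)
    then have "supp (a + b) \<subseteq> T" "supp (scale c a) \<subseteq> T" using T supp_scale by blast+
    then show "coeff (operator_series \<delta> f (a + b)) m = coeff (operator_series \<delta> f a + operator_series \<delta> f b) m"
      "coeff (operator_series \<delta> f (scale c a)) m = coeff (scale c (operator_series \<delta> f a)) m"
      using T by (simp_all add: coeff strongly_linear_add[OF sl] strongly_linear_scale[OF sl]
          sum.distrib distrib_left sum_distrib_left mult_ac)
  qed
  fix v I assume v: "summable_family (v :: 'm \<times> nat \<Rightarrow> ('m, 'k) nseries) I"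
  have sv: "summable_family ((\<delta> ^^ n) \<circ> v) I" "family_sum ((\<delta> ^^ n) \<circ> v) I = (\<delta> ^^ n) (family_sum v I)" for n
    using strongly_linear_family[OF sl v] by auto
  have "noetherian (\<Union>i\<in>I. supp (v i))" using v by (simp add: summable_family_def)
  then obtain T K where T: "(\<Union>i\<in>I. supp (v i)) \<subseteq> T" and K: "absorbing T K"
    by (rule absorbing_superset)
  note coeff = coeff_operator_series_absorbing[OF K]
  have vT: "supp (v i) \<subseteq> T" if "i \<in> I" for i using T that by blast
  have sumT: "supp (family_sum v I) \<subseteq> T" using supp_family_sum[OF v] T by blast
  define J where "J m = (\<Union>n<K m. {i \<in> I. m \<in> supp (((\<delta> ^^ n) \<circ> v) i)})" for m
  have J: "finite (J m)" "J m \<subseteq> I" for m using sv(1) by (auto simp: J_def summable_family_def)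
  have "coeff (operator_series \<delta> f (v i)) m = 0" if "i \<in> I - J m" for i m
    using that vT[of i] by (simp add: coeff J_def supp_def)
  then have suppJ: "{i \<in> I. m \<in> supp ((operator_series \<delta> f \<circ> v) i)} \<subseteq> J m" for m
    by (auto simp: supp_def)
  show s: "summable_family (operator_series \<delta> f \<circ> v) I"
    unfolding summable_family_def
  proof (intro conjI allI)
    have "(\<Union>i\<in>I. supp ((operator_series \<delta> f \<circ> v) i)) \<subseteq> T"
      using supp_operator_series_absorbing[OF K vT] by auto
    then show "noetherian (\<Union>i\<in>I. supp ((operator_series \<delta> f \<circ> v) i))"
      by (rule noetherian_subset[OF absorbing_noetherian[OF K]])
    show "finite {i \<in> I. m \<in> supp ((operator_series \<delta> f \<circ> v) i)}" for m
      using suppJ J(1) by (rule finite_subset)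
  qed
  show "family_sum (operator_series \<delta> f \<circ> v) I = operator_series \<delta> f (family_sum v I)"
  proof (rule nseries_eqI)
    fix m
    have sum: "coeff (family_sum (operator_series \<delta> f \<circ> v) I) m =
        (\<Sum>i\<in>J m. coeff ((operator_series \<delta> f \<circ> v) i) m)"
      by (rule coeff_family_sum_superset[OF s J(1) suppJ J(2)])
    have "coeff ((operator_series \<delta> f \<circ> v) i) m =
        (\<Sum>n<K m. f n * coeff (((\<delta> ^^ n) \<circ> v) i) m)" if "i \<in> J m" for i
      using coeff[OF vT, of i] J(2)[of m] that by auto
    then have "(\<Sum>i\<in>J m. coeff ((operator_series \<delta> f \<circ> v) i) m) =
        (\<Sum>i\<in>J m. \<Sum>n<K m. f n * coeff (((\<delta> ^^ n) \<circ> v) i) m)"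
      by (rule sum.cong[OF refl])
    also have "\<dots> = (\<Sum>n<K m. f n * (\<Sum>i\<in>J m. coeff (((\<delta> ^^ n) \<circ> v) i) m))"
      by (subst sum.swap) (simp add: sum_distrib_left)
    also have "\<dots> = (\<Sum>n<K m. f n * coeff (family_sum ((\<delta> ^^ n) \<circ> v) I) m)"
      using J by (intro sum.cong refl arg_cong2[where f = times]
          coeff_family_sum_superset[OF sv(1), symmetric]) (auto simp: J_def)
    also have "\<dots> = coeff (operator_series \<delta> f (family_sum v I)) m"
      using sumT by (simp add: coeff sv(2))
    finally show "coeff (family_sum (operator_series \<delta> f \<circ> v) I) m = coeff (operator_series \<delta> f (family_sum v I)) m"
      unfolding sum .
  qed
qed

lemma funpow_operator_series:
  "(\<delta> ^^ i) (operator_series \<delta> f a) = operator_series \<delta> f ((\<delta> ^^ i) a)"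
proof -
  note sl = strongly_linear_funpow[OF strongly_linear, of i]
  have "(\<delta> ^^ i) ((\<delta> ^^ n) a) = (\<delta> ^^ n) ((\<delta> ^^ i) a)" for n
    by (metis add.commute comp_apply funpow_add)
  then have "(\<delta> ^^ i) \<circ> (\<lambda>n. scale (f n) ((\<delta> ^^ n) a)) = (\<lambda>n. scale (f n) ((\<delta> ^^ n) ((\<delta> ^^ i) a)))"
    by (simp add: fun_eq_iff strongly_linear_scale[OF sl])
  then show ?thesis
    using strongly_linear_family[OF sl summable_operator_series[of f a]] by (simp add: operator_series_def)
qed

text \<open>Power series in \<open>\<delta>\<close> compose by the Cauchy product: at an exponent \<open>m\<close> both sides are sums over
  the pairs \<open>(i, j)\<close> with \<open>i + j < K m\<close>, arranged by rows or by diagonals.\<close>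

lemma operator_series_comp:
  "operator_series \<delta> f (operator_series \<delta> g a) = operator_series \<delta> (\<lambda>n. \<Sum>i\<le>n. f i * g (n - i)) a"
proof (rule nseries_eqI)
  fix m
  obtain T K where T: "supp a \<subseteq> T" "absorbing T K"
    using absorbing_superset[OF noetherian_supp[of a]] by blast
  note funpow = supp_funpow_absorbing[OF T(2,1)]
  note coeff = coeff_operator_series_absorbing[OF T(2)]
  define h where "h i j = f i * g j * coeff ((\<delta> ^^ (i + j)) a) m" for i j
  have "coeff (operator_series \<delta> f (operator_series \<delta> g a)) m =
      (\<Sum>i<K m. f i * coeff (operator_series \<delta> g ((\<delta> ^^ i) a)) m)"
    by (simp add: coeff supp_operator_series_absorbing[OF T(2,1)] funpow_operator_series)
  also have "\<dots> = (\<Sum>i<K m. \<Sum>j<K m. h i j)"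
  proof (rule sum.cong)
    fix i
    have "(\<delta> ^^ j) ((\<delta> ^^ i) a) = (\<delta> ^^ (i + j)) a" for j by (metis add.commute comp_apply funpow_add)
    then show "f i * coeff (operator_series \<delta> g ((\<delta> ^^ i) a)) m = (\<Sum>j<K m. h i j)"
      by (simp add: coeff funpow h_def sum_distrib_left mult.assoc)
  qed simp
  also have "\<dots> = (\<Sum>(i, j)\<in>{..<K m} \<times> {..<K m}. h i j)" by (simp add: sum.cartesian_product)
  also have "\<dots> = (\<Sum>(i, j)\<in>{(i, j). i + j < K m}. h i j)"
  proof (rule sum.mono_neutral_right)
    have "h i j = 0" if "\<not> i + j < K m" for i j
      using coeff_funpow_absorbing[OF T(2,1), of m "i + j"] that by (simp add: h_def)
    then show "\<forall>u\<in>{..<K m} \<times> {..<K m} - {(i, j). i + j < K m}. (case u of (i, j) \<Rightarrow> h i j) = 0"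
      by auto
  qed auto
  also have "\<dots> = (\<Sum>n<K m. \<Sum>i\<le>n. h i (n - i))" by (rule sum.triangle_reindex)
  also have "\<dots> = coeff (operator_series \<delta> (\<lambda>n. \<Sum>i\<le>n. f i * g (n - i)) a) m"
    by (simp add: coeff T(1) h_def sum_distrib_right)
  finally show "coeff (operator_series \<delta> f (operator_series \<delta> g a)) m = \<dots>" .
qed

lemma operator_series_minus_id_contracts:
  assumes f: "f 0 = 1" and p: "p \<in> supp (operator_series \<delta> f a - a)"
  shows "\<exists>q\<in>supp a. q < p"
proof -
  have pow: "\<exists>q\<in>supp a. q < p" if "p \<in> supp ((\<delta> ^^ Suc n) a)" for n p
    using that
  proof (induction n arbitrary: p)
    case 0
    then show ?case using contracts by simp
  next
    case (Suc n)
    then have "p \<in> supp (\<delta> ((\<delta> ^^ Suc n) a))" by simp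
    then obtain r where "r \<in> supp ((\<delta> ^^ Suc n) a)" "r < p" using contracts by blast
    with Suc.IH[of r] show ?case by (meson less_trans)
  qed
  obtain T K where T: "supp a \<subseteq> T" "absorbing T K"
    using absorbing_superset[OF noetherian_supp[of a]] by blast
  have "coeff (operator_series \<delta> f a) p = (\<Sum>n<Suc (K p). f n * coeff ((\<delta> ^^ n) a) p)"
    by (rule coeff_operator_series) (simp add: coeff_funpow_absorbing[OF T(2,1)])
  also have "\<dots> = coeff a p + (\<Sum>n<K p. f (Suc n) * coeff ((\<delta> ^^ Suc n) a) p)"
    unfolding sum.lessThan_Suc_shift by (simp add: f)
  finally have "(\<Sum>n<K p. f (Suc n) * coeff ((\<delta> ^^ Suc n) a) p) \<noteq> 0"
    using p by (simp add: supp_def)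
  then obtain n where "f (Suc n) * coeff ((\<delta> ^^ Suc n) a) p \<noteq> 0"
    by (rule sum.not_neutral_contains_not_neutral)
  then show ?thesis using pow[of p n] by (simp add: supp_def)
qed

end

section \<open>Polynomial functions\<close>

lemma poly_function_add:
  assumes "f \<in> range poly" "g \<in> range poly"
  shows "(\<lambda>x. f x + g x) \<in> range poly"
proof -
  from assms obtain p q where "f = poly p" "g = poly q" by blast
  then have "(\<lambda>x. f x + g x) = poly (p + q)" by (simp add: fun_eq_iff)
  then show ?thesis by blast
qed

lemma poly_function_mult:
  fixes f g :: "'a::comm_ring_1 \<Rightarrow> 'a"
  assumes "f \<in> range poly" "g \<in> range poly"
  shows "(\<lambda>x. f x * g x) \<in> range poly"
proof -
  from assms obtain p q where "f = poly p" "g = poly q" by blast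
  then have "(\<lambda>x. f x * g x) = poly (p * q)" by (simp add: fun_eq_iff)
  then show ?thesis by blast
qed

lemma poly_function_const: "(\<lambda>x. c) \<in> range poly"
  by (auto intro!: range_eqI[where x = "[:c:]"])

lemma poly_function_sum:
  assumes "\<And>i. i \<in> A \<Longrightarrow> f i \<in> range poly"
  shows "(\<lambda>x. \<Sum>i\<in>A. f i x) \<in> range poly"
  using assms
  by (induction A rule: infinite_finite_induct) (simp_all add: poly_function_const poly_function_add)

lemma poly_function_gbinomial: "(\<lambda>x::'a::field_char_0. x gchoose n) \<in> range poly"
proof (rule range_eqI)
  show "(\<lambda>x. x gchoose n) = poly (smult (inverse (fact n)) (\<Prod>i=0..<n. [:- of_nat i, 1:]))"
    by (rule ext) (simp add: gbinomial_prod_rev poly_prod field_simps)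
qed

text \<open>In characteristic zero the natural numbers are infinitely many points of the field.\<close>

lemma poly_function_eq_of_agree_on_nat:
  fixes f g :: "'a::field_char_0 \<Rightarrow> 'a"
  assumes "f \<in> range poly" "g \<in> range poly" "\<And>n::nat. f (of_nat n) = g (of_nat n)"
  shows "f = g"
proof -
  obtain p q where pq: "f = poly p" "g = poly q" using assms(1,2) by blast
  have "range of_nat \<subseteq> {x. poly (p - q) x = 0}" using assms(3) by (auto simp: pq)
  moreover have "infinite (range (of_nat :: nat \<Rightarrow> 'a))"
    by (rule range_inj_infinite) (simp add: inj_on_def)
  ultimately have "p - q = 0" using poly_roots_finite[of "p - q"] finite_subset by blast
  then show ?thesis by (simp add: pq)
qed

section \<open>Powers of an automorphism with exponents in the field\<close>

locale near_identity_morphism =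
  fixes \<sigma> :: "('m::partially_ordered_monoid_add, 'k::field_char_0) nseries \<Rightarrow> ('m, 'k) nseries"
  assumes strongly_linear_morphism: "strongly_linear \<sigma>"
    and morphism: "algebra_morphism \<sigma>"
    and near_identity: "a \<noteq> 0 \<Longrightarrow> precedes (\<sigma> a - a) a"
begin

sublocale contracting "\<lambda>a. \<sigma> a - a"
proof
  show "strongly_linear (\<lambda>a. \<sigma> a - a)"
    by (rule strongly_linear_minus_id) (rule strongly_linear_morphism)
  show "\<exists>q\<in>supp a. q < p" if "p \<in> supp (\<sigma> a - a)" for p a
    using that near_identity[of a] strongly_linear_zero[OF strongly_linear_morphism]
    by (cases "a = 0") (auto simp: precedes_def)
qed

definition scalar_power :: "'k \<Rightarrow> ('m, 'k) nseries \<Rightarrow> ('m, 'k) nseries" where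
  "scalar_power c = operator_series (\<lambda>a. \<sigma> a - a) (\<lambda>n. c gchoose n)"

lemma strongly_linear_scalar_power: "strongly_linear (scalar_power c)"
  unfolding scalar_power_def by (rule strongly_linear_operator_series)

lemma scalar_power_add: "scalar_power (c + d) a = scalar_power c (scalar_power d a)"
  by (simp add: scalar_power_def operator_series_comp gbinomial_Vandermonde[symmetric] atMost_atLeast0)

lemma coeff_scalar_power:
  assumes "\<And>n. n \<ge> K \<Longrightarrow> coeff (((\<lambda>a. \<sigma> a - a) ^^ n) a) m = 0"
  shows "coeff (scalar_power c a) m = (\<Sum>n<K. (c gchoose n) * coeff (((\<lambda>a. \<sigma> a - a) ^^ n) a) m)"
  unfolding scalar_power_def using assms by (rule coeff_operator_series)

lemma funpow_coeff_eventually_zero: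
  obtains K where "\<And>n. n \<ge> K \<Longrightarrow> coeff (((\<lambda>a. \<sigma> a - a) ^^ n) a) m = 0"
proof -
  obtain T K where T: "supp a \<subseteq> T" "absorbing T K"
    using absorbing_superset[OF noetherian_supp[of a]] by blast
  show ?thesis by (rule that[of "K m"]) (rule coeff_funpow_absorbing[OF T(2,1)])
qed

lemma scalar_power_0: "scalar_power 0 a = a"
proof (rule nseries_eqI)
  fix m
  obtain K where "\<And>n. n \<ge> K \<Longrightarrow> coeff (((\<lambda>a. \<sigma> a - a) ^^ n) a) m = 0"
    using funpow_coeff_eventually_zero by blast
  then have "coeff (scalar_power 0 a) m = (\<Sum>n<Suc K. (0 gchoose n) * coeff (((\<lambda>a. \<sigma> a - a) ^^ n) a) m)"
    by (intro coeff_scalar_power) simp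
  then show "coeff (scalar_power 0 a) m = coeff a m" unfolding sum.lessThan_Suc_shift by simp
qed

lemma scalar_power_1: "scalar_power 1 a = \<sigma> a"
proof (rule nseries_eqI)
  fix m
  obtain K where "\<And>n. n \<ge> K \<Longrightarrow> coeff (((\<lambda>a. \<sigma> a - a) ^^ n) a) m = 0"
    using funpow_coeff_eventually_zero by blast
  then have *: "coeff (scalar_power 1 a) m =
      (\<Sum>n<Suc (Suc K). (1 gchoose n) * coeff (((\<lambda>a. \<sigma> a - a) ^^ n) a) m)"
    by (intro coeff_scalar_power) simp
  have "(1 gchoose Suc (Suc n) :: 'k) = 0" for n
    using binomial_gbinomial[of 1 "Suc (Suc n)", where 'a = 'k] by simp
  then show "coeff (scalar_power 1 a) m = coeff (\<sigma> a) m" unfolding * sum.lessThan_Suc_shift by simp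
qed

lemma scalar_power_of_nat: "scalar_power (of_nat n) = \<sigma> ^^ n"
  by (induction n) (simp_all add: fun_eq_iff scalar_power_0 scalar_power_add scalar_power_1)

lemma coeff_scalar_power_polynomial: "(\<lambda>c. coeff (scalar_power c a) m) \<in> range poly"
proof -
  obtain K where "\<And>n. n \<ge> K \<Longrightarrow> coeff (((\<lambda>a. \<sigma> a - a) ^^ n) a) m = 0"
    using funpow_coeff_eventually_zero by blast
  then show ?thesis
    by (subst coeff_scalar_power)
      (auto intro!: poly_function_sum poly_function_mult poly_function_gbinomial poly_function_const)
qed

lemma funpow_morphism: "(\<sigma> ^^ n) (a * b) = (\<sigma> ^^ n) a * (\<sigma> ^^ n) b" "(\<sigma> ^^ n) 1 = 1"
  using morphism by (induction n) (auto simp: algebra_morphism_def)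

text \<open>For natural \<open>c\<close> this is the multiplicativity of the iterates of \<open>\<sigma>\<close>. Both sides are polynomial in
  \<open>c\<close> at every exponent; for the right-hand side, one has to know that the pairs of exponents that
  enter the Cauchy product come from a finite set independent of \<open>c\<close>, which the absorbing sets
  provide.\<close>

lemma scalar_power_mult: "scalar_power c (a * b) = scalar_power c a * scalar_power c b"
proof (rule nseries_eqI)
  fix m
  obtain S K where S: "supp a \<subseteq> S" "absorbing S K"
    using absorbing_superset[OF noetherian_supp[of a]] by blast
  obtain T L where T: "supp b \<subseteq> T" "absorbing T L"
    using absorbing_superset[OF noetherian_supp[of b]] by blast
  have "coeff (scalar_power c a * scalar_power c b) m =
      (\<Sum>(x, y) | x \<in> S \<and> y \<in> T \<and> x + y = m. coeff (scalar_power c a) x * coeff (scalar_power c b) y)" for c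
    using S T unfolding scalar_power_def
    by (intro coeff_times absorbing_noetherian supp_operator_series_absorbing)
  then have "(\<lambda>c. coeff (scalar_power c a * scalar_power c b) m) \<in> range poly"
    by (simp add: case_prod_unfold poly_function_sum poly_function_mult coeff_scalar_power_polynomial)
  then have "(\<lambda>c. coeff (scalar_power c (a * b)) m) = (\<lambda>c. coeff (scalar_power c a * scalar_power c b) m)"
    by (intro poly_function_eq_of_agree_on_nat coeff_scalar_power_polynomial)
      (simp_all add: scalar_power_of_nat funpow_morphism)
  then show "coeff (scalar_power c (a * b)) m = coeff (scalar_power c a * scalar_power c b) m" by meson
qed

lemma scalar_power_one: "scalar_power c 1 = 1"
proof (rule nseries_eqI)
  fix m
  have "(\<lambda>c. coeff (scalar_power c 1) m) = (\<lambda>c. coeff 1 m)"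
    by (intro poly_function_eq_of_agree_on_nat coeff_scalar_power_polynomial poly_function_const)
      (simp add: scalar_power_of_nat funpow_morphism)
  then show "coeff (scalar_power c 1) m = coeff 1 m" by meson
qed

lemma scalar_power_in_carrier: "scalar_power c \<in> carrier one_aut_plus"
proof -
  have "bij (scalar_power c)"
    by (rule o_bij[of "scalar_power (- c)"]) (simp_all add: fun_eq_iff scalar_power_0 flip: scalar_power_add)
  moreover have "algebra_morphism (scalar_power c)"
    using strongly_linear_scalar_power[of c]
    by (simp add: algebra_morphism_def strongly_linear_def scalar_power_mult scalar_power_one)
  moreover have "precedes (scalar_power c a - a) a" if "a \<noteq> 0" for a
    using that operator_series_minus_id_contracts[of "\<lambda>n. c gchoose n"]
    by (auto simp: precedes_def scalar_power_def)
  ultimately show ?thesis by (simp add: one_aut_plus_def strongly_linear_scalar_power)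
qed

text \<open>The polynomial \<open>c \<mapsto> coeff (scalar_power (n * c) a) m\<close> is constant on the natural numbers, hence
  constant; evaluate it at \<open>1 / n\<close>.\<close>

lemma eq_id_of_funpow_eq_id:
  assumes "n \<ge> 1" "\<sigma> ^^ n = id"
  shows "\<sigma> = id"
proof
  fix a
  show "\<sigma> a = id a"
  proof (rule nseries_eqI)
    fix m
    have "(\<lambda>c. coeff (scalar_power (of_nat n * c) a) m) = (\<lambda>c. coeff a m)"
    proof (rule poly_function_eq_of_agree_on_nat)
      obtain p where p: "(\<lambda>c. coeff (scalar_power c a) m) = poly p"
        using coeff_scalar_power_polynomial[of a m] by (rule rangeE)
      have "coeff (scalar_power (of_nat n * c) a) m = poly (p \<circ>\<^sub>p [:0, of_nat n:]) c" for c
        using fun_cong[OF p, of "of_nat n * c"] by (simp add: poly_pcompose mult.commute)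
      then have "(\<lambda>c. coeff (scalar_power (of_nat n * c) a) m) = poly (p \<circ>\<^sub>p [:0, of_nat n:])"
        by (rule ext)
      then show "(\<lambda>c. coeff (scalar_power (of_nat n * c) a) m) \<in> range poly" by (rule range_eqI)
      show "(\<lambda>c. coeff a m) \<in> range poly" by (rule poly_function_const)
      show "coeff (scalar_power (of_nat n * of_nat k) a) m = coeff a m" for k
      proof -
        have "\<sigma> ^^ (n * k) = id" by (simp add: assms(2) flip: funpow_mult)
        then show ?thesis using scalar_power_of_nat[of "n * k"] by simp
      qed
    qed
    from fun_cong[OF this, of "1 / of_nat n"] show "coeff (\<sigma> a) m = coeff (id a) m"
      using assms(1) by (simp add: scalar_power_1)
  qed
qed

end

section \<open>The group of automorphisms\<close>

lemma near_identity_morphismI: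
  fixes \<sigma> :: "('m::partially_ordered_monoid_add, 'k::field_char_0) nseries \<Rightarrow> ('m, 'k) nseries"
  shows "\<sigma> \<in> carrier one_aut_plus \<Longrightarrow> near_identity_morphism \<sigma>"
  by unfold_locales (auto simp: one_aut_plus_def)

lemma one_aut_plus_simps:
  "x \<otimes>\<^bsub>one_aut_plus\<^esub> y = x \<circ> y" "\<one>\<^bsub>one_aut_plus\<^esub> = id"
  by (simp_all add: one_aut_plus_def)

lemma one_aut_plus_pow: "x [^]\<^bsub>one_aut_plus\<^esub> (n::nat) = x ^^ n"
  by (induction n) (simp_all add: one_aut_plus_simps funpow_Suc_right del: funpow.simps(2))

lemma one_aut_plus_comp_closed:
  fixes \<sigma> \<tau> :: "('m::partially_ordered_monoid_add, 'k::field_char_0) nseries \<Rightarrow> ('m, 'k) nseries"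
  assumes \<sigma>: "\<sigma> \<in> carrier one_aut_plus" and \<tau>: "\<tau> \<in> carrier one_aut_plus"
  shows "\<sigma> \<circ> \<tau> \<in> carrier one_aut_plus"
proof -
  interpret \<sigma>: near_identity_morphism \<sigma> using \<sigma> by (rule near_identity_morphismI)
  interpret \<tau>: near_identity_morphism \<tau> using \<tau> by (rule near_identity_morphismI)
  have sl: "strongly_linear (\<sigma> \<circ> \<tau>)"
    by (rule strongly_linear_comp[OF \<sigma>.strongly_linear_morphism \<tau>.strongly_linear_morphism])
  have "\<exists>q\<in>supp a. q < p" if p: "p \<in> supp (\<sigma> (\<tau> a) - a)" for p a
  proof -
    have "p \<in> supp (\<tau> a - a) \<or> p \<in> supp (\<sigma> (\<tau> a) - \<tau> a)" using p by (auto simp: supp_def)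
    then show ?thesis
    proof
      assume "p \<in> supp (\<sigma> (\<tau> a) - \<tau> a)"
      then obtain q where q: "q \<in> supp (\<tau> a)" "q < p" using \<sigma>.contracts by blast
      show ?thesis
      proof (cases "q \<in> supp a")
        case False
        with q have "q \<in> supp (\<tau> a - a)" by (simp add: supp_def)
        with q(2) show ?thesis using \<tau>.contracts less_trans by blast
      qed (use q in blast)
    qed (rule \<tau>.contracts)
  qed
  then have "precedes ((\<sigma> \<circ> \<tau>) a - a) a" if "a \<noteq> 0" for a using that by (simp add: precedes_def)
  moreover have "algebra_morphism (\<sigma> \<circ> \<tau>)"
    using \<sigma>.morphism \<tau>.morphism sl by (simp add: algebra_morphism_def strongly_linear_def)
  moreover have "bij (\<sigma> \<circ> \<tau>)" using \<sigma> \<tau> by (simp add: one_aut_plus_def bij_comp)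
  ultimately show ?thesis using sl by (simp add: one_aut_plus_def)
qed

lemma group_one_aut_plus:
  "group (one_aut_plus ::
    (('m::partially_ordered_monoid_add, 'k::field_char_0) nseries \<Rightarrow> ('m, 'k) nseries) monoid)"
proof (rule groupI)
  show "\<one>\<^bsub>one_aut_plus\<^esub> \<in> carrier (one_aut_plus :: (('m, 'k) nseries \<Rightarrow> ('m, 'k) nseries) monoid)"
    using strongly_linear_id
    by (auto simp: one_aut_plus_def algebra_morphism_def strongly_linear_def precedes_def)
next
  fix \<sigma> :: "('m, 'k) nseries \<Rightarrow> ('m, 'k) nseries" assume \<sigma>: "\<sigma> \<in> carrier one_aut_plus"
  interpret near_identity_morphism \<sigma> using \<sigma> by (rule near_identity_morphismI)
  have "scalar_power (- 1) \<circ> \<sigma> = id"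
    using scalar_power_add[of "- 1" 1] by (simp add: fun_eq_iff scalar_power_0 scalar_power_1)
  then show "\<exists>\<tau>\<in>carrier one_aut_plus. \<tau> \<otimes>\<^bsub>one_aut_plus\<^esub> \<sigma> = \<one>\<^bsub>one_aut_plus\<^esub>"
    using scalar_power_in_carrier by (auto simp: one_aut_plus_simps)
qed (simp_all add: one_aut_plus_simps one_aut_plus_comp_closed comp_assoc)

lemma divisible_one_aut_plus:
  "divisible (one_aut_plus ::
    (('m::partially_ordered_monoid_add, 'k::field_char_0) nseries \<Rightarrow> ('m, 'k) nseries) monoid)"
  unfolding divisible_def
proof (intro allI impI ballI)
  fix n :: nat and \<sigma> :: "('m, 'k) nseries \<Rightarrow> ('m, 'k) nseries"
  assume n: "n \<ge> 1" and \<sigma>: "\<sigma> \<in> carrier one_aut_plus"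
  interpret near_identity_morphism \<sigma> using \<sigma> by (rule near_identity_morphismI)
  have "scalar_power c ^^ k = scalar_power (of_nat k * c)" for k c
    by (induction k) (simp_all add: fun_eq_iff scalar_power_0 scalar_power_add distrib_right)
  then have "scalar_power (1 / of_nat n) ^^ n = \<sigma>" using n by (simp add: fun_eq_iff scalar_power_1)
  then show "\<exists>\<tau>\<in>carrier one_aut_plus. \<sigma> = \<tau> [^]\<^bsub>one_aut_plus\<^esub> n"
    using scalar_power_in_carrier[of "1 / of_nat n"] by (auto simp: one_aut_plus_pow intro!: bexI)
qed

lemma torsion_free_one_aut_plus:
  "torsion_free (one_aut_plus ::
    (('m::partially_ordered_monoid_add, 'k::field_char_0) nseries \<Rightarrow> ('m, 'k) nseries) monoid)"
  unfolding torsion_free_def one_aut_plus_pow one_aut_plus_simps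
  using near_identity_morphism.eq_id_of_funpow_eq_id near_identity_morphismI by blast

theorem corollary3p16:
  fixes G :: "(('m::partially_ordered_monoid_add, 'k::field_char_0) nseries
    \<Rightarrow> ('m, 'k) nseries) monoid"
  assumes "G = one_aut_plus"
  shows "group G \<and> divisible G \<and> torsion_free G"
  unfolding assms
  using group_one_aut_plus divisible_one_aut_plus torsion_free_one_aut_plus by blast

end
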